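(* Let $\zeta \in C_0^\infty(\overline\Omega)$ be such that $\zeta > 0$ in $\Omega$. For every compact set $K\subset\partial\Omega$ such that $\mathcal{H}^{N-1}(K)=0$, there exists $u\in C^\infty(\overline\Omega\setminus K)\cap C_0(\overline\Omega)$ with $0<u\le\zeta$ in $\Omega$ such that (i) $D^2u\in L^1(\Omega)$ and $D^2u/u\in L^1(\Omega;\zeta\,dx)$, (ii) $\partial u/\partial n$ is well-defined in the classical sense and is continuous on $\partial\Omega$, (iii) for $x\in\partial\Omega$, $\partial u(x)/\partial n=0$ if and only if $x\in K$ or $\partial\zeta(x)/\partial n=0$. Thus, the function $V:=\Delta u/u$ belongs to $L^1(\Omega;\zeta\,dx)$; in particular, $Vu\in L^1(\Omega)$ and $$-\Delta u+Vu=0\quad\text{in }\Omega.$$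
   Context: $\Omega\subset\mathbb{R}^N$ ($N\ge1$) is a smooth bounded connected open set and $n$ is the outward unit normal on $\partial\Omega$. $C_0^\infty(\overline\Omega)$ is the set of functions smooth on $\overline\Omega$ that vanish on $\partial\Omega$; $C_0(\overline\Omega)$ is the set of continuous functions on $\overline\Omega$ that vanish on $\partial\Omega$. $L^1(\Omega;\zeta\,dx)$ is the weighted $L^1$ space with respect to the measure $\zeta\,dx$. $\mathcal{H}^{N-1}$ is the $(N-1)$-dimensional Hausdorff measure. *)

theory Defs
  imports "HOL-Analysis.Analysis"
begin

section \<open>Partial derivatives and smoothness\<close>

definition partial :: "'n::finite \<Rightarrow> (real^'n \<Rightarrow> real) \<Rightarrow> real^'n \<Rightarrow> real" where
  "partial i f x = frechet_derivative f (at x) (axis i 1)"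

definition hessian :: "(real^'n \<Rightarrow> real) \<Rightarrow> real^'n::finite \<Rightarrow> real^'n^'n" where
  "hessian f x = (\<chi> i j. partial i (partial j f) x)"

definition laplacian :: "(real^'n \<Rightarrow> real) \<Rightarrow> real^'n::finite \<Rightarrow> real" where
  "laplacian f x = (\<Sum>i\<in>UNIV. partial i (partial i f) x)"

primrec Ck_on :: "nat \<Rightarrow> (real^'n \<Rightarrow> real) \<Rightarrow> (real^'n::finite) set \<Rightarrow> bool" where
  "Ck_on 0 f U \<longleftrightarrow> continuous_on U f"
| "Ck_on (Suc k) f U \<longleftrightarrow> (\<forall>x\<in>U. f differentiable (at x)) \<and> (\<forall>i. Ck_on k (partial i f) U)"

text \<open>
  The predicate \<open>Ck_on\<close> is meaningful for open sets only.  On an arbitrary set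
  \<open>S\<close>, such as \<open>closure \<Omega> - K\<close>, a function is smooth if near every point
  of \<open>S\<close> it agrees on \<open>S\<close> with a function that is smooth on an open set.
\<close>

definition smooth_on :: "(real^'n::finite) set \<Rightarrow> (real^'n \<Rightarrow> real) \<Rightarrow> bool" where
  "smooth_on S f \<longleftrightarrow>
     (\<forall>x\<in>S. \<exists>U g. open U \<and> x \<in> U \<and> (\<forall>k. Ck_on k g U) \<and> (\<forall>y\<in>U \<inter> S. g y = f y))"


section \<open>Smooth boundary, outward unit normal, normal derivative\<close>

text \<open>
  Near \<open>x\<close>, the set \<open>\<Omega>\<close> lies strictly below a graph in the direction of the unit
  vector \<open>e\<close>.  The function \<open>\<gamma>\<close> is only evaluated at the projection of a point to
  the hyperplane orthogonal to \<open>e\<close>, so it plays the role of a smooth function of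
  the \<open>N - 1\<close> tangential variables (and of a constant if \<open>N = 1\<close>).
\<close>

definition graph_fun :: "real^'n \<Rightarrow> (real^'n \<Rightarrow> real) \<Rightarrow> real^'n::finite \<Rightarrow> real" where
  "graph_fun e \<gamma> y = y \<bullet> e - \<gamma> (y - (y \<bullet> e) *\<^sub>R e)"

definition local_graph ::
  "(real^'n::finite) set \<Rightarrow> real^'n \<Rightarrow> real \<Rightarrow> real^'n \<Rightarrow> (real^'n \<Rightarrow> real) \<Rightarrow> bool" where
  "local_graph \<Omega> x r e \<gamma> \<longleftrightarrow>
     r > 0 \<and> norm e = 1 \<and> smooth_on UNIV \<gamma> \<and>
     \<Omega> \<inter> ball x r = {y \<in> ball x r. graph_fun e \<gamma> y < 0}"

definition smooth_boundary :: "(real^'n::finite) set \<Rightarrow> bool" where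
  "smooth_boundary \<Omega> \<longleftrightarrow> (\<forall>x\<in>frontier \<Omega>. \<exists>r e \<gamma>. local_graph \<Omega> x r e \<gamma>)"

text \<open>
  The outward unit normal is the normalised gradient of a local graph function; it
  does not depend on the local graph, because two local graph functions at \<open>x\<close>
  vanish at \<open>x\<close>, are negative at the same points near \<open>x\<close> and have nonzero
  gradients at \<open>x\<close>, so these gradients are positive multiples of each other.
\<close>

definition outward_normal :: "(real^'n::finite) set \<Rightarrow> real^'n \<Rightarrow> real^'n" where
  "outward_normal \<Omega> x =
     (THE \<nu>. \<exists>r e \<gamma> w. local_graph \<Omega> x r e \<gamma> \<and> GDERIV (graph_fun e \<gamma>) x :> w \<and> \<nu> = sgn w)"

text \<open>
  The classical normal derivative at a boundary point is the limit of the difference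
  quotients along the normal line taken from inside \<open>\<Omega>\<close>, hence the one-sided filter.
\<close>

definition has_normal_derivative ::
  "(real^'n::finite) set \<Rightarrow> (real^'n \<Rightarrow> real) \<Rightarrow> real^'n \<Rightarrow> real \<Rightarrow> bool" where
  "has_normal_derivative \<Omega> f x d \<longleftrightarrow>
     ((\<lambda>t. f (x + t *\<^sub>R outward_normal \<Omega> x)) has_real_derivative d) (at_left 0)"

definition normal_derivative ::
  "(real^'n::finite) set \<Rightarrow> (real^'n \<Rightarrow> real) \<Rightarrow> real^'n \<Rightarrow> real" where
  "normal_derivative \<Omega> f x = (THE d. has_normal_derivative \<Omega> f x d)"


section \<open>Hausdorff measure\<close>

text \<open>
  The empty set contributes \<open>0\<close> also for \<open>d = 0\<close>, whereas a singleton then contributes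
  \<open>1\<close> (as \<open>0 ^ 0 = 1\<close>), so that the measure of dimension \<open>0\<close> is the counting measure.
  Boundedness of the covering sets is required because \<open>diameter\<close> is unspecified
  for unbounded sets.
\<close>

definition hausdorff_weight :: "nat \<Rightarrow> 'a::metric_space set \<Rightarrow> ennreal" where
  "hausdorff_weight d C =
     (if C = {} then 0 else ennreal (unit_ball_vol (real d) * (diameter C / 2) ^ d))"

definition hausdorff_content :: "nat \<Rightarrow> real \<Rightarrow> 'a::metric_space set \<Rightarrow> ennreal" where
  "hausdorff_content d \<delta> A =
     (INF C \<in> {C :: nat \<Rightarrow> 'a set. A \<subseteq> (\<Union>i. C i) \<and> (\<forall>i. bounded (C i) \<and> diameter (C i) \<le> \<delta>)}.
        \<Sum>i. hausdorff_weight d (C i))"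

definition hausdorff_measure :: "nat \<Rightarrow> 'a::metric_space set \<Rightarrow> ennreal" where
  "hausdorff_measure d A = (SUP \<delta>\<in>{0<..}. hausdorff_content d \<delta> A)"


section \<open>Function spaces\<close>

definition C0_closure :: "(real^'n::finite) set \<Rightarrow> (real^'n \<Rightarrow> real) set" where
  "C0_closure \<Omega> = {f. continuous_on (closure \<Omega>) f \<and> (\<forall>x\<in>frontier \<Omega>. f x = 0)}"

definition C0_infty_closure :: "(real^'n::finite) set \<Rightarrow> (real^'n \<Rightarrow> real) set" where
  "C0_infty_closure \<Omega> = {f. smooth_on (closure \<Omega>) f \<and> (\<forall>x\<in>frontier \<Omega>. f x = 0)}"

definition weighted_lebesgue_on ::
  "(real^'n::finite) set \<Rightarrow> (real^'n \<Rightarrow> real) \<Rightarrow> (real^'n) measure" where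
  "weighted_lebesgue_on \<Omega> \<zeta> = density (lebesgue_on \<Omega>) (\<lambda>x. ennreal (\<zeta> x))"

end

theory Submission
  imports Defs
begin

text \<open>
  The function is sought in the form \<open>u = \<zeta> * \<phi>\<close>, where the damping factor \<open>\<phi>\<close> is continuous, vanishes
  exactly on \<open>K\<close>, is smooth off \<open>K\<close> and satisfies \<open>0 \<le> \<phi> \<le> 1\<close>.  Since \<open>\<zeta> = 0\<close> on the boundary, the
  difference quotient of \<open>u\<close> along the normal line at a boundary point is the difference quotient of
  \<open>\<zeta>\<close> times \<open>\<phi>\<close>; hence the normal derivative of \<open>u\<close> is \<open>\<phi>\<close> times that of \<open>\<zeta>\<close>, at points of \<open>K\<close> as
  well (\<open>has_normal_derivative_mult_vanishing\<close>).  As the outward normal depends continuously on the boundary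
  point (\<open>continuous_on_outward_normal\<close>), so does the normal derivative of \<open>\<zeta>\<close>, and (ii) and (iii) follow.

  What remains is the integrability of \<open>D\<^sup>2u\<close> and of \<open>\<zeta> D\<^sup>2u / u = D\<^sup>2u / \<phi>\<close>.  Take \<open>\<phi> = 1 / h\<close>, where \<open>h\<close> is
  \<open>1\<close> plus a sum of bumps of height about one.  As \<open>K\<close> is compact with vanishing \<open>(N - 1)\<close>-dimensional
  measure, for each \<open>k\<close> it is covered by finitely many balls of radii \<open>r < 2\<^sup>-\<^sup>k\<close>, centred on \<open>K\<close>, with
  \<open>\<Sum> r\<^sup>N\<^sup>-\<^sup>1 \<le> 2\<^sup>-\<^sup>k\<close> (\<open>shrinking_ball_covers_exist\<close>), and each of these balls contributes one bump of
  width \<open>r\<close>.  The sum is locally finite off \<open>K\<close>, so \<open>h\<close> is smooth there, and every cover adds at least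
  \<open>1/2\<close> near \<open>K\<close>, so \<open>h\<close> tends to infinity at \<open>K\<close> (\<open>isCont_damping\<close>).

  The estimate rests on \<open>\<zeta>(x) \<le> L |x - y|\<close> for \<open>y\<close> on the boundary (\<open>boundary_distance_bound\<close>): on the
  support of a bump of width \<open>r\<close> centred on \<open>K\<close> the factor \<open>\<zeta>\<close> is at most a multiple of \<open>r\<close>, and absorbs
  one of the two powers of \<open>1/r\<close> that a second derivative produces.  The only term that is not linear
  in the bumps is \<open>\<zeta> |Dh|\<^sup>2 / h\<close>.  The bump profile satisfies \<open>|D\<eta>|\<^sup>2 \<le> C \<eta>\<close>, so the Cauchy-Schwarz
  inequality bounds \<open>|Dh|\<^sup>2\<close> by \<open>C h\<close> times the sum of \<open>r\<^sup>-\<^sup>2\<close> over the bumps whose support contains the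
  point, and this term is no worse than the others.  Altogether
  \<open>h |D\<^sup>2u| \<le> C (1 + \<Sum> r\<^sup>-\<^sup>1 1\<^sub>B)\<close>, the sum being over all the balls \<open>B\<close> that carry the supports
  (\<open>damped_hessian_bound\<close>).  Such a ball has volume of order \<open>r\<^sup>N\<close>, so the integral of the right-hand
  side is of order \<open>1 + \<Sum> r\<^sup>N\<^sup>-\<^sup>1\<close>, which is finite (\<open>integrable_majorant\<close>).
\<close>

section \<open>Calculus of iterated partial derivatives\<close>

lemma partial_eqI:
  assumes "(f has_derivative D) (at x)"
  shows "partial i f x = D (axis i 1)"
  unfolding partial_def using frechet_derivative_at[OF assms] by simp

lemma partial_cong:
  assumes "open U" "x \<in> U" "\<And>y. y \<in> U \<Longrightarrow> f y = g y"
  shows "partial i f x = partial i g x"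
proof -
  have "(f has_derivative D) (at x) \<longleftrightarrow> (g has_derivative D) (at x)" for D
    using has_derivative_transform_within_open[OF _ assms(1,2)] assms(3) by metis
  then show ?thesis
    unfolding partial_def frechet_derivative_def by simp
qed

lemma differentiable_cong_open:
  assumes "open U" "x \<in> U" "\<And>y. y \<in> U \<Longrightarrow> f y = g y" "f differentiable (at x)"
  shows "g differentiable (at x)"
  using assms unfolding differentiable_def by (metis has_derivative_transform_within_open)

lemma Ck_on_subset: "Ck_on k f U \<Longrightarrow> V \<subseteq> U \<Longrightarrow> Ck_on k f V"
  by (induction k arbitrary: f) (auto intro: continuous_on_subset)

lemma Ck_on_cong:
  assumes "open U" "\<And>y. y \<in> U \<Longrightarrow> f y = g y" "Ck_on k f U"
  shows "Ck_on k g U"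
  using assms(2,3)
proof (induction k arbitrary: f g)
  case 0
  then show ?case using continuous_on_cong[of U U f g] by simp
next
  case (Suc k)
  have "g differentiable (at x)" if "x \<in> U" for x
    using differentiable_cong_open[OF assms(1) that] Suc.prems that by auto
  moreover have "Ck_on k (partial i g) U" for i
  proof (rule Suc.IH)
    show "partial i f y = partial i g y" if "y \<in> U" for y
      by (rule partial_cong[OF assms(1) that Suc.prems(1)])
    show "Ck_on k (partial i f) U" using Suc.prems(2) by simp
  qed
  ultimately show ?case by simp
qed

lemma Ck_on_local:
  assumes "\<And>x. x \<in> S \<Longrightarrow> \<exists>U. open U \<and> x \<in> U \<and> Ck_on k f U"
  shows "Ck_on k f S"
  using assms
proof (induction k arbitrary: f)
  case 0
  have "isCont f x" if "x \<in> S" for x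
    using 0[OF that] by (auto simp: continuous_on_eq_continuous_at)
  then show ?case by (auto intro: continuous_at_imp_continuous_on)
next
  case (Suc k)
  have "Ck_on k (partial i f) S" for i
    using Suc.prems by (intro Suc.IH) (metis Ck_on.simps(2))
  moreover have "f differentiable (at x)" if "x \<in> S" for x
    using Suc.prems[OF that] by auto
  ultimately show ?case by simp
qed

lemma Ck_on_Suc_imp: "Ck_on (Suc k) f U \<Longrightarrow> Ck_on k f U"
proof (induction k arbitrary: f)
  case 0
  then show ?case
    by (auto intro!: continuous_at_imp_continuous_on differentiable_imp_continuous_within)
next
  case (Suc k)
  then show ?case by auto
qed

lemma Ck_on_const: "Ck_on k (\<lambda>x::real^'b::finite. c) U"
proof (induction k arbitrary: c)
  case (Suc k)
  have "partial i (\<lambda>x::real^'b. c) = (\<lambda>x. 0)" for i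
    by (rule ext) (simp add: partial_eqI[OF has_derivative_const])
  then show ?case using Suc[of 0] by simp
qed simp

lemma partial_coord: "partial i (\<lambda>x::real^'b::finite. x $ j) = (\<lambda>x. if i = j then 1 else 0)"
proof
  fix x :: "real^'b"
  have "((\<lambda>x::real^'b. x $ j) has_derivative (\<lambda>h. h $ j)) (at x)"
    by (rule bounded_linear_imp_has_derivative[OF bounded_linear_vec_nth])
  from partial_eqI[OF this] show "partial i (\<lambda>x. x $ j) x = (if i = j then 1 else 0)"
    by (simp add: axis_def)
qed

lemma Ck_on_coord: "Ck_on k (\<lambda>x::real^'b::finite. x $ j) U"
proof (cases k)
  case (Suc m)
  have "(\<lambda>x::real^'b. x $ j) differentiable (at x)" for x
    by (rule bounded_linear_imp_differentiable[OF bounded_linear_vec_nth])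
  then show ?thesis
    unfolding Suc by (auto simp: partial_coord Ck_on_const)
qed (simp add: continuous_intros)

lemma partial_add:
  assumes "f differentiable (at x)" "g differentiable (at x)"
  shows "partial i (\<lambda>x. f x + g x) x = partial i f x + partial i g x"
proof -
  obtain F G where FG: "(f has_derivative F) (at x)" "(g has_derivative G) (at x)"
    using assms by (auto simp: differentiable_def)
  show ?thesis
    using partial_eqI[OF has_derivative_add[OF FG]] FG[THEN partial_eqI] by simp
qed

lemma partial_mult:
  assumes "f differentiable (at x)" "g differentiable (at x)"
  shows "partial i (\<lambda>x. f x * g x) x = f x * partial i g x + partial i f x * g x"
proof -
  obtain F G where FG: "(f has_derivative F) (at x)" "(g has_derivative G) (at x)"
    using assms by (auto simp: differentiable_def)
  show ?thesis
    using partial_eqI[OF has_derivative_mult[OF FG]] FG[THEN partial_eqI] by simp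
qed

lemma partial_compose_real:
  assumes "(F has_real_derivative F') (at (q x))" "q differentiable (at x)"
  shows "partial i (\<lambda>x. F (q x)) x = F' * partial i q x"
    and "(\<lambda>x. F (q x)) differentiable (at x)"
proof -
  obtain D where D: "(q has_derivative D) (at x)"
    using assms by (auto simp: differentiable_def)
  have *: "((\<lambda>x. F (q x)) has_derivative (\<lambda>h. F' * D h)) (at x)"
    using has_derivative_compose[OF D assms(1)[unfolded has_field_derivative_def]] by simp
  show "partial i (\<lambda>x. F (q x)) x = F' * partial i q x"
    using partial_eqI[OF *] D[THEN partial_eqI] by simp
  show "(\<lambda>x. F (q x)) differentiable (at x)"
    using * by (auto simp: differentiable_def)
qed

lemma partial_sum:
  assumes "finite I" "\<And>j. j \<in> I \<Longrightarrow> f j differentiable (at x)"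
  shows "partial i (\<lambda>x. \<Sum>j\<in>I. f j x) x = (\<Sum>j\<in>I. partial i (f j) x)"
proof -
  have "(f j has_derivative frechet_derivative (f j) (at x)) (at x)" if "j \<in> I" for j
    using assms(2)[OF that] frechet_derivative_works by blast
  from partial_eqI[OF has_derivative_sum[OF this]] show ?thesis
    by (simp add: partial_def)
qed

lemma Ck_on_add:
  assumes "open U" "Ck_on k f U" "Ck_on k g U"
  shows "Ck_on k (\<lambda>x. f x + g x) U"
  using assms(2,3)
proof (induction k arbitrary: f g)
  case 0
  then show ?case by (auto intro: continuous_on_add)
next
  case (Suc k)
  have "Ck_on k (partial i (\<lambda>x. f x + g x)) U" for i
    by (rule Ck_on_cong[OF assms(1) _ Suc.IH[of "partial i f" "partial i g"]])
      (use Suc.prems in \<open>simp_all add: partial_add\<close>)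
  moreover have "(\<lambda>x. f x + g x) differentiable (at x)" if "x \<in> U" for x
    using Suc.prems that by (intro differentiable_add) simp_all
  ultimately show ?case by simp
qed

lemma Ck_on_mult:
  assumes "open U" "Ck_on k f U" "Ck_on k g U"
  shows "Ck_on k (\<lambda>x. f x * g x) U"
  using assms(2,3)
proof (induction k arbitrary: f g)
  case 0
  then show ?case by (auto intro: continuous_on_mult)
next
  case (Suc k)
  have "Ck_on k (partial i (\<lambda>x. f x * g x)) U" for i
  proof (rule Ck_on_cong[OF assms(1)])
    show "Ck_on k (\<lambda>x. f x * partial i g x + partial i f x * g x) U"
      using Suc.prems Suc.prems[THEN Ck_on_Suc_imp]
      by (intro Ck_on_add[OF assms(1)] Suc.IH) auto
    show "f x * partial i g x + partial i f x * g x = partial i (\<lambda>x. f x * g x) x" if "x \<in> U" for x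
      using Suc.prems that by (intro partial_mult[symmetric]) auto
  qed
  moreover have "(\<lambda>x. f x * g x) differentiable (at x)" if "x \<in> U" for x
    using Suc.prems that by (intro differentiable_mult) simp_all
  ultimately show ?case by simp
qed

lemma Ck_on_sum:
  assumes "open U" "finite I" "\<And>j. j \<in> I \<Longrightarrow> Ck_on k (f j) U"
  shows "Ck_on k (\<lambda>x. \<Sum>j\<in>I. f j x) U"
  using assms(2,3)
proof (induction I rule: finite_induct)
  case (insert j I)
  then have "Ck_on k (\<lambda>x. f j x + (\<Sum>j\<in>I. f j x)) U"
    by (intro Ck_on_add[OF assms(1)]) auto
  with insert.hyps show ?case by simp
qed (simp add: Ck_on_const)

lemma partial_inverse:
  assumes "f differentiable (at x)" "f x \<noteq> 0"
  shows "partial i (\<lambda>z. inverse (f z)) x = - (inverse (f x) * inverse (f x)) * partial i f x"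
    and "(\<lambda>z. inverse (f z)) differentiable (at x)"
  using partial_compose_real[OF DERIV_inverse[OF assms(2)] assms(1)]
  by (simp_all add: power2_eq_square)

lemma Ck_on_inverse:
  assumes "open U" "Ck_on k f U" "\<And>x. x \<in> U \<Longrightarrow> f x \<noteq> 0"
  shows "Ck_on k (\<lambda>x. inverse (f x)) U"
  using assms(2)
proof (induction k)
  case 0
  then show ?case using assms(3) by (auto intro: continuous_on_inverse)
next
  case (Suc k)
  have fd: "f differentiable (at x)" if "x \<in> U" for x using Suc.prems that by auto
  have inv: "Ck_on k (\<lambda>x. inverse (f x)) U"
    by (rule Suc.IH[OF Ck_on_Suc_imp[OF Suc.prems]])
  have "Ck_on k (partial i (\<lambda>x. inverse (f x))) U" for i
  proof (rule Ck_on_cong[OF assms(1)])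
    show "Ck_on k (\<lambda>x. (-1 * (inverse (f x) * inverse (f x))) * partial i f x) U"
      using Suc.prems by (intro Ck_on_mult[OF assms(1)] inv Ck_on_const) auto
    show "-1 * (inverse (f x) * inverse (f x)) * partial i f x = partial i (\<lambda>x. inverse (f x)) x"
      if "x \<in> U" for x
      using partial_inverse(1)[OF fd[OF that] assms(3)[OF that]] by simp
  qed
  moreover have "(\<lambda>x. inverse (f x)) differentiable (at x)" if "x \<in> U" for x
    by (rule partial_inverse(2)[OF fd[OF that] assms(3)[OF that]])
  ultimately show ?case unfolding Ck_on.simps by blast
qed

lemma second_partial_cong:
  assumes "open U" "x \<in> U" "\<And>z. z \<in> U \<Longrightarrow> f z = g z"
  shows "partial i (partial j f) x = partial i (partial j g) x"
proof (rule partial_cong[OF assms(1,2)])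
  fix y assume "y \<in> U"
  show "partial j f y = partial j g y"
    by (rule partial_cong[OF assms(1) \<open>y \<in> U\<close>]) (rule assms(3))
qed

lemma second_partial_mult:
  assumes "open U" "x \<in> U" "Ck_on 2 f U" "Ck_on 2 g U"
  shows "partial i (partial j (\<lambda>z. f z * g z)) x =
    f x * partial i (partial j g) x + partial i f x * partial j g x
    + partial j f x * partial i g x + partial i (partial j f) x * g x"
proof -
  have d: "f differentiable (at z)" "g differentiable (at z)"
      "partial j f differentiable (at z)" "partial j g differentiable (at z)" if "z \<in> U" for z
    using assms(3,4) that by (simp_all add: numeral_2_eq_2)
  have "partial i (partial j (\<lambda>z. f z * g z)) x
      = partial i (\<lambda>z. f z * partial j g z + partial j f z * g z) x"
    by (rule partial_cong[OF assms(1,2)]) (simp add: partial_mult d)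
  also have "\<dots> = partial i (\<lambda>z. f z * partial j g z) x + partial i (\<lambda>z. partial j f z * g z) x"
    using d[OF assms(2)] by (intro partial_add differentiable_mult)
  finally show ?thesis
    using d[OF assms(2)] by (simp add: partial_mult)
qed

lemma second_partial_inverse:
  assumes "open U" "x \<in> U" "Ck_on 2 f U" "\<And>z. z \<in> U \<Longrightarrow> f z \<noteq> 0"
  shows "partial i (partial j (\<lambda>z. inverse (f z))) x =
    - (inverse (f x))\<^sup>2 * partial i (partial j f) x
    + 2 * (inverse (f x)) ^ 3 * (partial i f x * partial j f x)"
proof -
  have d: "f differentiable (at z)" "partial j f differentiable (at z)" if "z \<in> U" for z
    using assms(3) that by (simp_all add: numeral_2_eq_2)
  note inv = partial_inverse[OF d(1) assms(4)]
  let ?k = "\<lambda>z. inverse (f z)"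
  have "partial i (partial j ?k) x = partial i (\<lambda>z. - 1 * ((?k z * ?k z) * partial j f z)) x"
    by (rule partial_cong[OF assms(1,2)]) (simp add: inv)
  also have "\<dots> = - 1 * partial i (\<lambda>z. (?k z * ?k z) * partial j f z) x"
    using assms(2) by (subst partial_mult)
      (auto intro!: differentiable_mult inv d simp: partial_eqI[OF has_derivative_const])
  also have "partial i (\<lambda>z. (?k z * ?k z) * partial j f z) x
      = ?k x * ?k x * partial i (partial j f) x + partial i (\<lambda>z. ?k z * ?k z) x * partial j f x"
    using assms(2) by (intro partial_mult differentiable_mult inv d)
  also have "partial i (\<lambda>z. ?k z * ?k z) x = ?k x * partial i ?k x + partial i ?k x * ?k x"
    using assms(2) by (intro partial_mult inv)
  finally show ?thesis
    using assms(2) by (simp add: inv power2_eq_square power3_eq_cube algebra_simps)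
qed

lemma smooth_on_open_imp_Ck_on:
  assumes "open S" "smooth_on S f"
  shows "Ck_on k f S"
proof (rule Ck_on_local)
  fix x assume "x \<in> S"
  then obtain U g where U: "open U" "x \<in> U" "Ck_on k g U" "\<forall>y\<in>U \<inter> S. g y = f y"
    using assms(2) unfolding smooth_on_def by metis
  have "Ck_on k f (U \<inter> S)"
    by (rule Ck_on_cong[OF _ _ Ck_on_subset[OF U(3)]]) (use U assms in auto)
  then show "\<exists>U. open U \<and> x \<in> U \<and> Ck_on k f U"
    using U assms \<open>x \<in> S\<close> by (metis Int_iff open_Int)
qed

lemma smooth_on_subset:
  assumes "smooth_on S f" "T \<subseteq> S"
  shows "smooth_on T f"
  unfolding smooth_on_def
proof
  fix x assume "x \<in> T"
  with assms(2) have "x \<in> S" by blast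
  with assms(1) obtain U g where "open U" "x \<in> U" "\<forall>k. Ck_on k g U" "\<forall>y\<in>U \<inter> S. g y = f y"
    unfolding smooth_on_def by blast
  then show "\<exists>U g. open U \<and> x \<in> U \<and> (\<forall>k. Ck_on k g U) \<and> (\<forall>y\<in>U \<inter> T. g y = f y)"
    using assms(2) by (intro exI[of _ U] exI[of _ g]) blast
qed

lemma smooth_on_imp_continuous_on: "smooth_on S f \<Longrightarrow> continuous_on S f"
proof (subst continuous_on_eq_continuous_within, intro ballI)
  fix x assume "smooth_on S f" "x \<in> S"
  then obtain U g where U: "open U" "x \<in> U" "Ck_on 0 g U" "\<forall>y\<in>U \<inter> S. g y = f y"
    unfolding smooth_on_def by blast
  have "continuous_on (S \<inter> U) g" using U(3) by (auto intro: continuous_on_subset)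
  then have "continuous_on (S \<inter> U) f"
    using continuous_on_cong[OF refl, of "S \<inter> U" g f] U(4) by simp
  then have "continuous (at x within S \<inter> U) f"
    using U(2) \<open>x \<in> S\<close> by (simp add: continuous_on_eq_continuous_within)
  then show "continuous (at x within S) f"
    using at_within_nhd[OF U(2,1), of "S \<inter> U" S] by (simp add: continuous_within Int_assoc)
qed

lemma continuous_on_hessian:
  assumes "open U" "Ck_on 2 f U"
  shows "continuous_on U (hessian f)"
  unfolding hessian_def
  using assms(2) by (intro continuous_on_vec_lambda) (simp add: numeral_2_eq_2)

text \<open>
  The row of partial derivatives represents the derivative, so that \<open>partial\<close> is the gradient in
  the sense used by \<open>GDERIV\<close>.
\<close>

lemma has_derivative_partials:
  assumes "f differentiable (at x)"
  shows "(f has_derivative (\<lambda>h. h \<bullet> (\<chi> i. partial i f x))) (at x)"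
proof -
  let ?D = "frechet_derivative f (at x)"
  have D: "(f has_derivative ?D) (at x)" using assms frechet_derivative_works by blast
  then have lin: "linear ?D" by (rule has_derivative_linear)
  have "?D h = h \<bullet> (\<chi> i. partial i f x)" for h
  proof -
    have "?D h = ?D (\<Sum>i\<in>UNIV. h $ i *\<^sub>R axis i 1)"
      by (simp add: basis_expansion[of h, unfolded scalar_mult_eq_scaleR])
    also have "\<dots> = (\<Sum>i\<in>UNIV. h $ i * ?D (axis i 1))"
      by (simp add: linear_sum[OF lin] linear_scale[OF lin])
    finally show ?thesis by (simp add: inner_vec_def partial_def)
  qed
  then have "?D = (\<lambda>h. h \<bullet> (\<chi> i. partial i f x))" by blast
  with D show ?thesis by simp
qed

lemma norm_matrix_le: "norm (A :: real^'n::finite^'m::finite) \<le> (\<Sum>i\<in>UNIV. \<Sum>j\<in>UNIV. \<bar>A $ i $ j\<bar>)"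
proof -
  have "norm A \<le> (\<Sum>i\<in>UNIV. norm (A $ i))"
    unfolding norm_vec_def[of A] by (rule L2_set_le_sum) simp
  also have "\<dots> \<le> (\<Sum>i\<in>UNIV. \<Sum>j\<in>UNIV. \<bar>A $ i $ j\<bar>)"
    by (intro sum_mono norm_le_l1_cart)
  finally show ?thesis .
qed

section \<open>A smooth bump\<close>

text \<open>
  All derivatives of \<open>exp (- 1 / t)\<close>, extended by zero to \<open>t \<le> 0\<close>, are combinations of the members
  of this family, which makes the smoothness proof a plain induction.
\<close>

definition flat :: "nat \<Rightarrow> real \<Rightarrow> real" where
  "flat k t = (if t \<le> 0 then 0 else exp (- inverse t) * inverse t ^ k)"

lemma flat_nonneg: "0 \<le> flat k t"
  by (simp add: flat_def)

text \<open>
  The exponential series dominates each of its terms.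
\<close>

lemma power_exp_bound:
  fixes s :: real
  assumes "0 \<le> s"
  shows "exp (- s) * s ^ k \<le> fact k"
proof -
  have "(\<Sum>n\<in>{k}. s ^ n /\<^sub>R fact n) \<le> exp s"
    unfolding exp_def by (rule sum_le_suminf[OF summable_exp_generic]) (use assms in auto)
  then show ?thesis
    by (simp add: exp_minus field_simps)
qed

lemma flat_le_fact: "flat k t \<le> fact k"
  using power_exp_bound[of "inverse t" k] by (auto simp: flat_def)

text \<open>
  Trading powers of \<open>t\<close> for a larger index shows that each member is flat at \<open>0\<close>; the case \<open>m = 2\<close>
  gives differentiability there.
\<close>

lemma flat_le_power: "flat k t \<le> fact (k + m) * \<bar>t\<bar> ^ m"
proof (cases "t \<le> 0")
  case False
  then have "flat k t = flat (k + m) t * t ^ m"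
    by (simp add: flat_def power_add field_simps)
  also have "\<dots> \<le> fact (k + m) * t ^ m"
    using False by (intro mult_right_mono flat_le_fact) auto
  finally show ?thesis using False by simp
qed (simp add: flat_def)

text \<open>
  As \<open>flat 2\<close> is the derivative of \<open>flat 0\<close>, this is the inequality \<open>|f'|\<^sup>2 \<le> C f\<close>, the property
  of the profile that makes the gradient term of the final estimate summable.
\<close>

lemma flat_2_squared: "(flat 2 t)\<^sup>2 \<le> 24 * flat 0 t"
proof (cases "t \<le> 0")
  case False
  have "(flat 2 t)\<^sup>2 = flat 4 t * flat 0 t"
    using False by (simp add: flat_def power2_eq_square power4_eq_xxxx)
  also have "\<dots> \<le> fact 4 * flat 0 t"
    by (intro mult_right_mono flat_le_fact flat_nonneg)
  finally show ?thesis by (simp add: fact_numeral)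
qed (simp add: flat_def)

lemma flat_0_ge: "3 \<le> t \<Longrightarrow> 1 / 2 \<le> flat 0 t"
proof -
  assume "3 \<le> t"
  then have "inverse t \<le> 1 / 3" by (simp add: field_simps)
  then have "1 / 2 \<le> 1 + (- inverse t)" by simp
  also have "\<dots> \<le> exp (- inverse t)" by (rule exp_ge_add_one_self)
  finally show ?thesis using \<open>3 \<le> t\<close> by (simp add: flat_def)
qed

lemma flat_has_derivative:
  "(flat k has_real_derivative flat (k + 2) t - real k * flat (k + 1) t) (at t)"
proof -
  consider "t < 0" | "t > 0" | "t = 0" by linarith
  then show ?thesis
  proof cases
    case 1
    have "((\<lambda>_. 0) has_real_derivative 0) (at t)" by simp
    then have "(flat k has_real_derivative 0) (at t)"
      by (rule has_field_derivative_transform_within_open[of _ _ _ "{..<0}"])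
        (use 1 in \<open>auto simp: flat_def\<close>)
    then show ?thesis using 1 by (simp add: flat_def)
  next
    case 2
    have "((\<lambda>t. exp (- inverse t) * inverse t ^ k) has_real_derivative
        exp (- inverse t) * inverse t ^ (k + 2) - real k * (exp (- inverse t) * inverse t ^ (k + 1))) (at t)"
    proof (cases k)
      case (Suc m)
      have "real k * inverse t ^ (k - Suc 0) * inverse t ^ 2 = real k * inverse t ^ (k + 1)"
        by (simp add: Suc power2_eq_square)
      then show ?thesis
        using 2 by (auto intro!: derivative_eq_intros simp: power2_eq_square algebra_simps)
    qed (use 2 in \<open>auto intro!: derivative_eq_intros simp: power2_eq_square\<close>)
    then have "(flat k has_real_derivative
        exp (- inverse t) * inverse t ^ (k + 2) - real k * (exp (- inverse t) * inverse t ^ (k + 1))) (at t)"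
      by (rule has_field_derivative_transform_within_open[of _ _ _ "{0<..}"])
        (use 2 in \<open>auto simp: flat_def\<close>)
    then show ?thesis using 2 by (simp add: flat_def)
  next
    case 3
    have "((\<lambda>s. flat k s / s) \<longlongrightarrow> 0) (at 0)"
    proof (rule Lim_null_comparison)
      show "\<forall>\<^sub>F s in at 0. norm (flat k s / s) \<le> fact (k + 2) * \<bar>s\<bar>"
        unfolding eventually_at_filter
      proof (rule always_eventually, intro allI impI)
        fix s :: real assume "s \<noteq> 0"
        then show "norm (flat k s / s) \<le> fact (k + 2) * \<bar>s\<bar>"
          using flat_le_power[of k s 2] flat_nonneg[of k s]
          unfolding real_norm_def abs_divide
          by (subst pos_divide_le_eq) (simp_all add: power2_eq_square mult.assoc del: fact_Suc add_2_eq_Suc')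
      qed
      show "((\<lambda>s::real. fact (k + 2) * \<bar>s\<bar>) \<longlongrightarrow> 0) (at 0)"
        by (intro tendsto_mult_right_zero tendsto_rabs_zero tendsto_ident_at)
    qed
    then show ?thesis
      using 3 by (simp add: has_field_derivative_iff flat_def)
  qed
qed

lemma Ck_on_flat:
  assumes "open U" "\<And>m. Ck_on m q U"
  shows "Ck_on m (\<lambda>x. flat k (q x)) U"
proof (induction m arbitrary: k)
  case 0
  have "continuous_on UNIV (flat k)"
    using flat_has_derivative DERIV_isCont by (blast intro: continuous_at_imp_continuous_on)
  with assms(2)[of 0] show ?case
    using continuous_on_compose2[of UNIV "flat k" U q] by simp
next
  case (Suc m)
  have qd: "q differentiable (at x)" if "x \<in> U" for x using assms(2)[of 1] that by simp
  note der = partial_compose_real[OF flat_has_derivative qd]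
  have "Ck_on m (partial i (\<lambda>x. flat k (q x))) U" for i
  proof (rule Ck_on_cong[OF assms(1)])
    show "Ck_on m (\<lambda>x. (flat (k + 2) (q x) + (- real k) * flat (k + 1) (q x)) * partial i q x) U"
      using assms(2)[of "Suc m"]
      by (intro Ck_on_mult Ck_on_add Ck_on_const Suc.IH assms(1)) auto
    show "(flat (k + 2) (q x) + (- real k) * flat (k + 1) (q x)) * partial i q x
        = partial i (\<lambda>x. flat k (q x)) x" if "x \<in> U" for x
      using der(1)[OF that] by simp
  qed
  with der(2) show ?case by simp
qed

text \<open>
  The constant \<open>4\<close> makes the support the closed ball of radius \<open>2 * r\<close> while the bump stays above
  \<open>1/2\<close> on the ball of radius \<open>r\<close>.
\<close>

definition bump :: "real^'n::finite \<Rightarrow> real \<Rightarrow> real^'n \<Rightarrow> real" where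
  "bump y r x = flat 0 (4 - (norm (x - y) / r)\<^sup>2)"

lemma bump_nonneg: "0 \<le> bump y r x"
  by (simp add: bump_def flat_nonneg)

lemma bump_le_1: "bump y r x \<le> 1"
  using flat_le_fact[of 0] by (simp add: bump_def)

lemma bump_ge:
  assumes "0 < r" "x \<in> ball y r"
  shows "1 / 2 \<le> bump y r x"
proof -
  have "norm (x - y) / r \<le> 1" using assms by (simp add: dist_norm norm_minus_commute)
  then have "(norm (x - y) / r)\<^sup>2 \<le> 1" using assms by (intro power_le_one) auto
  then show ?thesis unfolding bump_def by (intro flat_0_ge) auto
qed

lemma flat_quadratic_eq_0:
  assumes "0 < r" "x \<notin> ball y (2 * r)"
  shows "flat k (4 - (norm (x - y) / r)\<^sup>2) = 0"
proof -
  have "2 \<le> norm (x - y) / r" using assms by (simp add: dist_norm norm_minus_commute field_simps)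
  then have "2\<^sup>2 \<le> (norm (x - y) / r)\<^sup>2" by (intro power_mono) auto
  then show ?thesis by (simp add: flat_def)
qed

lemma bump_eq_0: "0 < r \<Longrightarrow> x \<notin> ball y (2 * r) \<Longrightarrow> bump y r x = 0"
  by (simp add: bump_def flat_quadratic_eq_0)

text \<open>
  With \<open>1 / 0 = 0\<close> these formulas hold for \<open>r = 0\<close> as well, where \<open>q\<close> is constant.
\<close>

lemma quadratic_partials:
  fixes y :: "real^'n::finite" and r :: real
  defines "q \<equiv> \<lambda>x. 4 - (norm (x - y) / r)\<^sup>2"
  shows "q differentiable (at x)"
    and "partial i q = (\<lambda>x. (- 2 / r\<^sup>2) * (x $ i + (- y $ i)))"
    and "partial i (partial j q) x = (if i = j then - 2 / r\<^sup>2 else 0)"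
    and "Ck_on m q U"
proof -
  have der: "(q has_derivative (\<lambda>h. (- 2 / r\<^sup>2) * (h \<bullet> (x - y)))) (at x)" for x
  proof -
    define c where "c = 1 / r\<^sup>2"
    have q: "q = (\<lambda>x. 4 - c * ((x - y) \<bullet> (x - y)))"
      by (simp add: q_def c_def power_divide power2_norm_eq_inner fun_eq_iff)
    have "(q has_derivative (\<lambda>h. (- 2 * c) * (h \<bullet> (x - y)))) (at x)" unfolding q
      by (auto intro!: derivative_eq_intros simp: inner_commute algebra_simps)
    then show ?thesis by (simp add: c_def)
  qed
  then show "q differentiable (at x)" for x by (auto simp: differentiable_def)
  note d = this
  show p: "partial i q = (\<lambda>x. (- 2 / r\<^sup>2) * (x $ i + (- y $ i)))" for i
    by (rule ext) (simp add: partial_eqI[OF der] inner_axis' )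
  have lin: "Ck_on m (\<lambda>x. x $ i + (- y $ i)) UNIV" for m i
    by (intro Ck_on_add Ck_on_coord Ck_on_const) auto
  have *: "partial i (\<lambda>x. x $ j + (- y $ j)) x = (if i = j then 1 else 0)" for i j x
    using partial_add[of "\<lambda>x. x $ j" x "\<lambda>x. - y $ j" i] Ck_on_coord[of 1 j UNIV]
    by (simp add: partial_coord partial_eqI[OF has_derivative_const])
  show "partial i (partial j q) x = (if i = j then - 2 / r\<^sup>2 else 0)"
    unfolding p using lin[of 1 j]
    by (subst partial_mult)
      (auto simp: * partial_eqI[OF has_derivative_const] simp del: add_uminus_conv_diff)
  have "Ck_on m q UNIV"
  proof (cases m)
    case 0
    then show ?thesis using d by (auto intro!: continuous_at_imp_continuous_on differentiable_imp_continuous_within)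
  next
    case (Suc l)
    have "Ck_on l (partial i q) UNIV" for i
      unfolding p by (intro Ck_on_mult lin Ck_on_const) auto
    with Suc d show ?thesis by simp
  qed
  then show "Ck_on m q U" by (rule Ck_on_subset) simp
qed

lemma Ck_on_bump: "open U \<Longrightarrow> Ck_on m (bump y r) U"
  unfolding bump_def[abs_def] by (intro Ck_on_flat quadratic_partials(4))

lemma partial_quadratic_bound:
  fixes y :: "real^'n::finite"
  assumes "0 < r" "x \<in> ball y (2 * r)"
  shows "\<bar>partial i (\<lambda>x. 4 - (norm (x - y) / r)\<^sup>2) x\<bar> \<le> 4 / r"
proof -
  have "\<bar>x $ i - y $ i\<bar> \<le> norm (x - y)"
    using component_le_norm_cart[of "x - y" i] by simp
  also have "\<dots> \<le> 2 * r" using assms by (simp add: dist_norm norm_minus_commute)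
  finally have "2 / r\<^sup>2 * \<bar>x $ i - y $ i\<bar> \<le> 2 / r\<^sup>2 * (2 * r)"
    by (intro mult_left_mono) auto
  then show ?thesis
    unfolding quadratic_partials(2) abs_mult
    using assms by (simp add: power2_eq_square)
qed

lemma partial_bump:
  fixes y :: "real^'b::finite"
  shows "partial i (bump y r) = (\<lambda>x. flat 2 (4 - (norm (x - y) / r)\<^sup>2)
      * partial i (\<lambda>x. 4 - (norm (x - y) / r)\<^sup>2) x)"
proof
  fix x :: "real^'b"
  show "partial i (bump y r) x = flat 2 (4 - (norm (x - y) / r)\<^sup>2)
      * partial i (\<lambda>x. 4 - (norm (x - y) / r)\<^sup>2) x"
    unfolding bump_def[abs_def]
    using partial_compose_real(1)[OF flat_has_derivative[of 0] quadratic_partials(1)[of y r x], of i]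
    by (simp add: numeral_2_eq_2)
qed

text \<open>
  This is \<open>|D\<eta>| \<le> C sqrt \<eta> / r\<close>, from \<open>flat_2_squared\<close>: compared with the uniform bound \<open>C / r\<close>
  it keeps a factor that the Cauchy-Schwarz inequality turns back into the sum of the bumps.
\<close>

lemma partial_bump_bound:
  assumes "0 < r"
  shows "\<bar>partial i (bump y r) x\<bar> \<le> sqrt (bump y r x) * (20 / r * indicator (ball y (2 * r)) x)"
proof (cases "x \<in> ball y (2 * r)")
  case True
  let ?q = "4 - (norm (x - y) / r)\<^sup>2"
  have "(flat 2 ?q)\<^sup>2 \<le> 25 * bump y r x"
    using flat_2_squared[of ?q] bump_nonneg[of y r x] by (simp add: bump_def)
  then have "sqrt ((flat 2 ?q)\<^sup>2) \<le> sqrt (5\<^sup>2 * bump y r x)" by (intro real_sqrt_le_mono) simp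
  then have "flat 2 ?q \<le> 5 * sqrt (bump y r x)"
    using flat_nonneg[of 2 ?q] by (simp add: real_sqrt_mult)
  then have "flat 2 ?q * \<bar>partial i (\<lambda>x. 4 - (norm (x - y) / r)\<^sup>2) x\<bar>
      \<le> 5 * sqrt (bump y r x) * (4 / r)"
    by (intro mult_mono partial_quadratic_bound assms True) (auto simp: bump_nonneg)
  then show ?thesis
    using True by (simp add: partial_bump abs_mult flat_nonneg mult.commute)
qed (simp add: partial_bump flat_quadratic_eq_0 assms)

lemma partial_bump_bound_uniform:
  assumes "0 < r"
  shows "\<bar>partial i (bump y r) x\<bar> \<le> 20 / r * indicator (ball y (2 * r)) x"
proof -
  have "sqrt (bump y r x) * (20 / r * indicator (ball y (2 * r)) x)
      \<le> 1 * (20 / r * indicator (ball y (2 * r)) x)"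
    using bump_le_1[of y r x] assms by (intro mult_right_mono) auto
  with partial_bump_bound[OF assms, of i y x] show ?thesis by simp
qed

lemma second_partial_bump_bound:
  fixes y :: "real^'n::finite"
  assumes "0 < r"
  shows "\<bar>partial i (partial j (bump y r)) x\<bar> \<le> 1000 / r\<^sup>2 * indicator (ball y (2 * r)) x"
proof -
  let ?Q = "\<lambda>x::real^'n. 4 - (norm (x - y) / r)\<^sup>2"
  have q2: "partial j ?Q differentiable (at x)" 
    using quadratic_partials(4)[of 2 y r UNIV] by (simp add: numeral_2_eq_2)
  note fl = partial_compose_real[OF flat_has_derivative[of 2] quadratic_partials(1)[of y r x]]
  have eq: "partial i (partial j (bump y r)) x =
      flat 2 (?Q x) * partial i (partial j ?Q) x
      + ((flat 4 (?Q x) - 2 * flat 3 (?Q x)) * partial i ?Q x) * partial j ?Q x"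
    unfolding partial_bump using partial_mult[OF fl(2) q2] fl(1)[of i] by simp
  show ?thesis
  proof (cases "x \<in> ball y (2 * r)")
    case True
    have A: "\<bar>flat 2 (?Q x) * partial i (partial j ?Q) x\<bar> \<le> 2 * (2 / r\<^sup>2)"
      unfolding abs_mult
      using flat_le_fact[of 2 "?Q x"] flat_nonneg[of 2 "?Q x"]
      by (intro mult_mono) (auto simp: quadratic_partials(3))
    have B: "\<bar>flat 4 (?Q x) - 2 * flat 3 (?Q x)\<bar> \<le> 24"
      using flat_le_fact[of 4 "?Q x"] flat_nonneg[of 4 "?Q x"]
        flat_le_fact[of 3 "?Q x"] flat_nonneg[of 3 "?Q x"] by (auto simp: fact_numeral)
    have "\<bar>((flat 4 (?Q x) - 2 * flat 3 (?Q x)) * partial i ?Q x) * partial j ?Q x\<bar>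
        \<le> (24 * (4 / r)) * (4 / r)"
      unfolding abs_mult
      using assms by (intro mult_mono B partial_quadratic_bound True) auto
    with A have "\<bar>partial i (partial j (bump y r)) x\<bar> \<le> 2 * (2 / r\<^sup>2) + (24 * (4 / r)) * (4 / r)"
      unfolding eq by linarith
    also have "\<dots> \<le> 1000 / r\<^sup>2" using assms by (simp add: field_simps power2_eq_square)
    finally show ?thesis using True by simp
  qed (simp add: eq flat_quadratic_eq_0 assms)
qed

section \<open>Ball covers of sets of Hausdorff measure zero\<close>

text \<open>
  An efficient countable cover of \<open>K\<close> by arbitrary small sets becomes one by open balls: replace each
  set that meets \<open>K\<close> by a ball centred at a point of \<open>K\<close> in it, of a radius exceeding the diameter so
  slightly that the sum of the powers grows by at most \<open>\<epsilon> / 2\<close>.  Compactness selects finitely many.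
  For \<open>d = 0\<close> the sum counts the balls, so for \<open>\<epsilon> \<le> 1\<close> the cover is empty, as is \<open>K\<close>.
\<close>

lemma hausdorff_null_finite_ball_cover:
  fixes K :: "'a::metric_space set"
  assumes "compact K" "hausdorff_measure d K = 0" "0 < \<epsilon>" "0 < \<delta>"
  obtains F where "finite F" "\<And>y r. (y, r) \<in> F \<Longrightarrow> y \<in> K \<and> 0 < r \<and> r < \<delta>"
    "K \<subseteq> (\<Union>(y, r)\<in>F. ball y r)" "(\<Sum>(y, r)\<in>F. r ^ d) < \<epsilon>"
proof -
  \<comment> \<open>the weight of a nonempty set is \<open>c\<close> times the \<open>d\<close>-th power of its diameter\<close>
  define c where "c = unit_ball_vol (real d) / 2 ^ d"
  have c: "0 < c" by (simp add: c_def)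
  have "hausdorff_content d (\<delta> / 2) K \<le> 0"
    unfolding assms(2)[symmetric] hausdorff_measure_def
    using assms(4) by (intro SUP_upper) auto
  also have "0 < ennreal (c * (\<epsilon> / 2))" using c assms(3) by simp
  finally obtain C where C: "K \<subseteq> (\<Union>i. C i)" "\<And>i. bounded (C i)" "\<And>i. diameter (C i) \<le> \<delta> / 2"
      "(\<Sum>i. hausdorff_weight d (C i)) < ennreal (c * (\<epsilon> / 2))"
    unfolding hausdorff_content_def INF_less_iff by auto
  have "\<exists>\<rho>. diameter (C i) < \<rho> \<and> \<rho> < \<delta> \<and> \<rho> ^ d < diameter (C i) ^ d + \<epsilon> / 2 * (1 / 2) ^ Suc i" for i
  proof -
    let ?D = "diameter (C i)"
    have "((\<lambda>\<rho>. \<rho> ^ d) \<longlongrightarrow> ?D ^ d) (at_right ?D)" by (intro tendsto_intros)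
    then have "\<forall>\<^sub>F \<rho> in at_right ?D. \<rho> ^ d < ?D ^ d + \<epsilon> / 2 * (1 / 2) ^ Suc i"
      by (rule order_tendstoD) (use assms(3) in simp)
    moreover have "\<forall>\<^sub>F \<rho> in at_right ?D. \<rho> < \<delta>"
      using C(3)[of i] assms(4) by (intro order_tendstoD(2)[OF tendsto_ident_at]) simp
    moreover have "\<forall>\<^sub>F \<rho> in at_right ?D. ?D < \<rho>" by (rule eventually_at_right_less)
    ultimately have "\<forall>\<^sub>F \<rho> in at_right ?D. ?D < \<rho> \<and> \<rho> < \<delta> \<and> \<rho> ^ d < ?D ^ d + \<epsilon> / 2 * (1 / 2) ^ Suc i"
      by eventually_elim simp
    then show ?thesis
      using eventually_happens'[OF trivial_limit_at_right_real] by blast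
  qed
  then obtain \<rho> where \<rho>: "\<And>i. diameter (C i) < \<rho> i" "\<And>i. \<rho> i < \<delta>"
      "\<And>i. \<rho> i ^ d < diameter (C i) ^ d + \<epsilon> / 2 * (1 / 2) ^ Suc i"
    by metis
  have \<rho>_pos: "0 < \<rho> i" for i
    using \<rho>(1)[of i] diameter_ge_0[OF C(2)[of i]] by linarith
  define I where "I = {i. C i \<inter> K \<noteq> {}}"
  define y where "y i = (SOME z. z \<in> C i \<inter> K)" for i
  have y: "y i \<in> C i" "y i \<in> K" if "i \<in> I" for i
    using that someI_ex[of "\<lambda>z. z \<in> C i \<inter> K"] by (auto simp: I_def y_def)
  have "K \<subseteq> (\<Union>i\<in>I. ball (y i) (\<rho> i))"
  proof
    fix z assume "z \<in> K"
    then obtain i where "z \<in> C i" using C(1) by blast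
    with \<open>z \<in> K\<close> have i: "z \<in> C i" "i \<in> I" by (auto simp: I_def)
    have "dist (y i) z \<le> diameter (C i)"
      by (rule diameter_bounded_bound[OF C(2) y(1)[OF i(2)] i(1)])
    with \<rho>(1)[of i] i show "z \<in> (\<Union>i\<in>I. ball (y i) (\<rho> i))" by fastforce
  qed
  then obtain J where J: "J \<subseteq> I" "finite J" "K \<subseteq> (\<Union>i\<in>J. ball (y i) (\<rho> i))"
    using compactE_image[OF assms(1), of I "\<lambda>i. ball (y i) (\<rho> i)"] by auto
  show thesis
  proof (rule that[of "(\<lambda>i. (y i, \<rho> i)) ` J"])
    show "finite ((\<lambda>i. (y i, \<rho> i)) ` J)" using J by simp
    show "K \<subseteq> (\<Union>(y, r)\<in>(\<lambda>i. (y i, \<rho> i)) ` J. ball y r)" using J by auto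
    show "z \<in> K \<and> 0 < r \<and> r < \<delta>" if "(z, r) \<in> (\<lambda>i. (y i, \<rho> i)) ` J" for z r
      using that J y \<rho>(2) \<rho>_pos by auto
    have "ennreal (\<Sum>i\<in>J. c * diameter (C i) ^ d) = (\<Sum>i\<in>J. hausdorff_weight d (C i))"
    proof -
      have "C i \<noteq> {}" if "i \<in> J" for i using y(1) J(1) that by blast
      then show ?thesis
        using c C(2) by (subst sum_ennreal[symmetric])
          (auto simp: hausdorff_weight_def c_def power_divide diameter_ge_0 intro!: sum.cong)
    qed
    also have "\<dots> \<le> (\<Sum>i. hausdorff_weight d (C i))"
      using J(2) by (intro sum_le_suminf) auto
    also have "\<dots> < ennreal (c * (\<epsilon> / 2))" by (rule C(4))
    finally have "c * (\<Sum>i\<in>J. diameter (C i) ^ d) < c * (\<epsilon> / 2)"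
      using c assms(3) by (subst (asm) ennreal_less_iff)
        (auto simp: sum_distrib_left diameter_ge_0 C(2) intro!: sum_nonneg)
    then have 1: "(\<Sum>i\<in>J. diameter (C i) ^ d) < \<epsilon> / 2" using c by simp
    have "(\<Sum>i\<in>J. (1 / 2) ^ Suc i) \<le> (\<Sum>i. (1 / 2 :: real) ^ Suc i)"
      using J(2) by (intro sum_le_suminf) (auto intro: sums_summable[OF power_half_series])
    also have "\<dots> = 1" using power_half_series sums_unique by fastforce
    finally have "\<epsilon> / 2 * (\<Sum>i\<in>J. (1 / 2) ^ Suc i) \<le> \<epsilon> / 2 * 1"
      using assms(3) by (intro mult_left_mono) auto
    then have 2: "(\<Sum>i\<in>J. \<epsilon> / 2 * (1 / 2) ^ Suc i) \<le> \<epsilon> / 2"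
      unfolding sum_distrib_left by simp
    have "(\<Sum>(y, r)\<in>(\<lambda>i. (y i, \<rho> i)) ` J. r ^ d) \<le> (\<Sum>i\<in>J. \<rho> i ^ d)"
      using sum_image_le[OF J(2), of "\<lambda>(y, r). r ^ d" "\<lambda>i. (y i, \<rho> i)"] less_imp_le[OF \<rho>_pos]
      by (simp add: o_def)
    also have "\<dots> \<le> (\<Sum>i\<in>J. diameter (C i) ^ d + \<epsilon> / 2 * (1 / 2) ^ Suc i)"
      using \<rho>(3) by (intro sum_mono less_imp_le)
    also have "\<dots> < \<epsilon>" using 1 2 by (simp only: sum.distrib)
    finally show "(\<Sum>(y, r)\<in>(\<lambda>i. (y i, \<rho> i)) ` J. r ^ d) < \<epsilon>" .
  qed
qed

text \<open>
  The radii of the \<open>k\<close>-th cover tend to zero so that only finitely many balls come near a point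
  outside \<open>K\<close>, and their \<open>(N - 1)\<close>-st powers are summable over all covers together.
\<close>

locale shrinking_ball_covers =
  fixes K :: "(real^'n::finite) set" and F :: "nat \<Rightarrow> ((real^'n) \<times> real) set"
  assumes compact: "compact K"
    and finite_cover: "\<And>k. finite (F k)"
    and centre: "\<And>k y r. (y, r) \<in> F k \<Longrightarrow> y \<in> K"
    and radius_pos: "\<And>k y r. (y, r) \<in> F k \<Longrightarrow> 0 < r"
    and radius_less: "\<And>k y r. (y, r) \<in> F k \<Longrightarrow> r < (1 / 2) ^ k"
    and cover: "\<And>k. K \<subseteq> (\<Union>(y, r)\<in>F k. ball y r)"
    and sum_radius: "\<And>k. (\<Sum>(y, r)\<in>F k. r ^ (CARD('n) - 1)) \<le> (1 / 2) ^ k"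

lemma shrinking_ball_covers_exist:
  fixes K :: "(real^'n::finite) set"
  assumes "compact K" "hausdorff_measure (CARD('n) - 1) K = 0"
  obtains F where "shrinking_ball_covers K F"
proof -
  let ?P = "\<lambda>k::nat. \<lambda>F. finite F \<and> (\<forall>(y, r)\<in>F. y \<in> K \<and> 0 < r \<and> r < (1 / 2) ^ k)
      \<and> K \<subseteq> (\<Union>(y, r)\<in>F. ball y r) \<and> (\<Sum>(y, r)\<in>F. r ^ (CARD('n) - 1)) < (1 / 2) ^ k"
  have "\<forall>k. \<exists>F. ?P k F"
  proof
    fix k
    show "\<exists>F. ?P k F"
  proof (rule hausdorff_null_finite_ball_cover[OF assms, of "(1 / 2) ^ k" "(1 / 2) ^ k"])
    fix F
    assume "finite F" "\<And>y r. (y, r) \<in> F \<Longrightarrow> y \<in> K \<and> 0 < r \<and> r < (1 / 2) ^ k"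
      "K \<subseteq> (\<Union>(y, r)\<in>F. ball y r)" "(\<Sum>(y, r)\<in>F. r ^ (CARD('n) - 1)) < (1 / 2) ^ k"
    then show ?thesis by (intro exI[of _ F]) auto
  qed auto
  qed
  then have "\<exists>F. \<forall>k. ?P k (F k)" by (rule choice)
  then obtain F where F: "\<And>k. ?P k (F k)" by blast
  have "shrinking_ball_covers K F"
  proof
    fix k y r assume "(y, r) \<in> F k"
    with F[of k] show "y \<in> K" "0 < r" "r < (1 / 2) ^ k" by auto
  next
    fix k
    from F[of k] show "finite (F k)" "K \<subseteq> (\<Union>(y, r)\<in>F k. ball y r)"
      "(\<Sum>(y, r)\<in>F k. r ^ (CARD('n) - 1)) \<le> (1 / 2) ^ k" by auto
  qed (rule assms(1))
  then show thesis by (rule that)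
qed

section \<open>The damping factor of a shrinking sequence of ball covers\<close>

context shrinking_ball_covers
begin

definition bumps :: "nat \<Rightarrow> real^'n \<Rightarrow> real" where
  "bumps k x = (\<Sum>(y, r)\<in>F k. bump y r x)"

text \<open>
  The series is a finite sum near each point outside \<open>K\<close>; on \<open>K\<close> it diverges.
\<close>

definition height :: "real^'n \<Rightarrow> real" where
  "height x = 1 + (\<Sum>k. bumps k x)"

text \<open>
  Up to constants this dominates both the first derivatives of the bumps of the \<open>k\<close>-th cover and
  their second derivatives multiplied by the distance to \<open>K\<close>.
\<close>

definition ball_density :: "nat \<Rightarrow> real^'n \<Rightarrow> real" where
  "ball_density k x = (\<Sum>(y, r)\<in>F k. 1 / r * indicator (ball y (2 * r)) x)"

definition majorant :: "real^'n \<Rightarrow> real" where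
  "majorant x = (\<Sum>k. ball_density k x)"

definition damping :: "real^'n \<Rightarrow> real" where
  "damping x = (if x \<in> K then 0 else inverse (height x))"

lemma bumps_nonneg: "0 \<le> bumps k x"
  unfolding bumps_def by (auto intro!: sum_nonneg bump_nonneg)

lemma ball_density_nonneg: "0 \<le> ball_density k x"
  unfolding ball_density_def by (fastforce intro!: sum_nonneg dest: radius_pos)

text \<open>
  If the ball of radius \<open>e\<close> about \<open>x\<close> misses \<open>K\<close>, then the ball of half that radius misses all supports of the
  \<open>k\<close>-th cover once \<open>2\<^sup>-\<^sup>k\<close> is below \<open>e / 4\<close>, since these supports stay within twice \<open>2\<^sup>-\<^sup>k\<close> of \<open>K\<close>.
\<close>

lemma locally_finite:
  assumes "x \<notin> K"
  obtains V m where "open V" "x \<in> V" "V \<inter> K = {}"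
    "\<And>k z. m \<le> k \<Longrightarrow> z \<in> V \<Longrightarrow> bumps k z = 0"
    "\<And>k z. m \<le> k \<Longrightarrow> z \<in> V \<Longrightarrow> ball_density k z = 0"
proof -
  have "open (- K)" using compact_imp_closed[OF compact] by (rule open_Compl)
  then obtain e where e: "0 < e" "ball x e \<subseteq> - K"
    using assms openE[of "- K" x] by blast
  obtain m where m: "(1 / 2 :: real) ^ m < e / 4"
    using real_arch_pow_inv[of "e / 4" "1 / 2"] e(1) by auto
  have far: "z \<notin> ball y (2 * r)" if "m \<le> k" "z \<in> ball x (e / 2)" "(y, r) \<in> F k" for k z y r
  proof
    assume "z \<in> ball y (2 * r)"
    then have "dist y z < 2 * r" by simp
    moreover have "(1 / 2 :: real) ^ k \<le> (1 / 2) ^ m" using that(1) by (intro power_decreasing) auto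
    ultimately have "r < e / 4" "dist y z < 2 * r" using radius_less[OF that(3)] m by linarith+
    then have "dist x y < e"
      using that(2) dist_triangle[of x y z] by (simp add: dist_commute)
    with e(2) centre[OF that(3)] show False by auto
  qed
  show thesis
  proof (rule that)
    show "ball x (e / 2) \<inter> K = {}" using e subset_ball[of "e / 2" e x] by auto
    show "bumps k z = 0" if "m \<le> k" "z \<in> ball x (e / 2)" for k z
      unfolding bumps_def using far[OF that] radius_pos by (auto intro!: sum.neutral bump_eq_0)
    show "ball_density k z = 0" if "m \<le> k" "z \<in> ball x (e / 2)" for k z
      unfolding ball_density_def using far[OF that] by (auto intro!: sum.neutral)
  qed (use e(1) in auto)
qed

lemma
  assumes "x \<notin> K"
  shows summable_bumps: "summable (\<lambda>k. bumps k x)"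
    and summable_ball_density: "summable (\<lambda>k. ball_density k x)"
proof -
  obtain V m where *: "x \<in> V"
      "\<And>k z. m \<le> k \<Longrightarrow> z \<in> V \<Longrightarrow> bumps k z = 0"
      "\<And>k z. m \<le> k \<Longrightarrow> z \<in> V \<Longrightarrow> ball_density k z = 0"
    using locally_finite[OF assms] by metis
  show "summable (\<lambda>k. bumps k x)" "summable (\<lambda>k. ball_density k x)"
    by (rule summable_finite[of "{..<m}"]; simp add: *(2,3)[OF _ *(1)])+
qed

lemma majorant_nonneg: "x \<notin> K \<Longrightarrow> 0 \<le> majorant x"
  unfolding majorant_def by (intro suminf_nonneg summable_ball_density ball_density_nonneg)

lemma height_ge: "x \<notin> K \<Longrightarrow> 1 + (\<Sum>k<m. bumps k x) \<le> height x"
  unfolding height_def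
  by (intro add_left_mono sum_le_suminf summable_bumps bumps_nonneg) auto

lemma height_ge_1: "x \<notin> K \<Longrightarrow> 1 \<le> height x"
  using height_ge[of x 0] by simp

text \<open>
  Indices are triples \<open>(k, y, r)\<close>, because the same ball may occur in several covers and then counts
  several times.
\<close>

lemma height_local:
  assumes "x \<notin> K"
  obtains V and I :: "(nat \<times> (real^'n) \<times> real) set" where
    "open V" "x \<in> V" "V \<inter> K = {}" "finite I"
    "\<And>i. i \<in> I \<Longrightarrow> fst (snd i) \<in> K \<and> 0 < snd (snd i)"
    "\<And>z. z \<in> V \<Longrightarrow> height z = 1 + (\<Sum>i\<in>I. bump (fst (snd i)) (snd (snd i)) z)"
    "\<And>z. z \<in> V \<Longrightarrow> majorant z
        = (\<Sum>i\<in>I. 1 / snd (snd i) * indicator (ball (fst (snd i)) (2 * snd (snd i))) z)"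
proof -
  obtain V m where V: "open V" "x \<in> V" "V \<inter> K = {}"
      "\<And>k z. m \<le> k \<Longrightarrow> z \<in> V \<Longrightarrow> bumps k z = 0"
      "\<And>k z. m \<le> k \<Longrightarrow> z \<in> V \<Longrightarrow> ball_density k z = 0"
    using locally_finite[OF assms] by metis
  let ?I = "SIGMA k:{..<m}. F k"
  show thesis
  proof (rule that[OF V(1-3), of ?I])
    show "finite ?I" by (intro finite_SigmaI finite_cover) simp
    show "fst (snd i) \<in> K \<and> 0 < snd (snd i)" if "i \<in> ?I" for i
      using that centre radius_pos by force
    show "height z = 1 + (\<Sum>i\<in>?I. bump (fst (snd i)) (snd (snd i)) z)" if "z \<in> V" for z
    proof -
      have "(\<Sum>k. bumps k z) = (\<Sum>k<m. bumps k z)"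
        using V(4)[OF _ that] by (intro suminf_finite) auto
      then show ?thesis
        by (simp add: height_def bumps_def sum.Sigma finite_cover case_prod_unfold)
    qed
    show "majorant z
        = (\<Sum>i\<in>?I. 1 / snd (snd i) * indicator (ball (fst (snd i)) (2 * snd (snd i))) z)" if "z \<in> V" for z
    proof -
      have "(\<Sum>k. ball_density k z) = (\<Sum>k<m. ball_density k z)"
        using V(5)[OF _ that] by (intro suminf_finite) auto
      then show ?thesis
        by (simp add: majorant_def ball_density_def sum.Sigma finite_cover case_prod_unfold
            del: mult_cancel_left1)
    qed
  qed
qed

lemma open_minus_K: "open (- K)"
  using compact_imp_closed[OF compact] by (rule open_Compl)

lemma Ck_on_height: "Ck_on k height (- K)"
proof (rule Ck_on_local)
  fix x assume "x \<in> - K"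
  then have "x \<notin> K" by simp
  then obtain V and I :: "(nat \<times> (real^'n) \<times> real) set" where V: "open V" "x \<in> V" "finite I"
    "\<And>z. z \<in> V \<Longrightarrow> height z = 1 + (\<Sum>i\<in>I. bump (fst (snd i)) (snd (snd i)) z)"
    by (rule height_local) blast
  have "Ck_on k (\<lambda>z. 1 + (\<Sum>i\<in>I. bump (fst (snd i)) (snd (snd i)) z)) V"
    by (intro Ck_on_add Ck_on_sum Ck_on_const Ck_on_bump V)
  then have "Ck_on k height V"
    by (rule Ck_on_cong[OF V(1), rotated]) (simp add: V(4))
  with V(1,2) show "\<exists>U. open U \<and> x \<in> U \<and> Ck_on k height U" by blast
qed

lemma Ck_on_damping: "Ck_on k damping (- K)"
proof (rule Ck_on_cong[OF open_minus_K])
  show "Ck_on k (\<lambda>x. inverse (height x)) (- K)"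
    using height_ge_1 by (intro Ck_on_inverse open_minus_K Ck_on_height) force
qed (simp add: damping_def)

lemma damping_pos: "x \<notin> K \<Longrightarrow> 0 < damping x"
  using height_ge_1[of x] by (simp add: damping_def)

lemma damping_nonneg: "0 \<le> damping x"
  using damping_pos[of x] by (cases "x \<in> K") (simp_all add: damping_def)

lemma damping_le_1: "damping x \<le> 1"
  using height_ge_1[of x] by (simp add: damping_def inverse_le_1_iff)

text \<open>
  At a point of \<open>K\<close>: the first \<open>m\<close> covers are open neighbourhoods of \<open>K\<close> and each of them adds at
  least \<open>1/2\<close> to the height.
\<close>

lemma isCont_damping: "isCont damping x"
proof (cases "x \<in> K")
  case False
  have "continuous_on (- K) damping" using Ck_on_damping[of 0] by simp
  with False open_minus_K show ?thesis by (auto simp: continuous_on_eq_continuous_at)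
next
  case True
  have small: "\<forall>\<^sub>F z in nhds x. damping z < e" if "0 < e" for e
  proof -
    obtain m :: nat where m: "2 / e < real m" using reals_Archimedean2 by blast
    with that have m': "1 / e < real m / 2" by (simp add: field_simps)
    have "\<forall>\<^sub>F z in nhds x. \<forall>k\<in>{..<m}. z \<in> (\<Union>(y, r)\<in>F k. ball y r)"
    proof (subst eventually_ball_finite_distrib, simp, intro ballI)
      fix k
      have "open (\<Union>(y, r)\<in>F k. ball y r)" by auto
      then show "\<forall>\<^sub>F z in nhds x. z \<in> (\<Union>(y, r)\<in>F k. ball y r)"
        using subsetD[OF cover True] by (rule eventually_nhds_in_open)
    qed
    then show ?thesis
    proof eventually_elim
      case (elim z)
      show "damping z < e"
      proof (cases "z \<in> K")
        case False
        have "1 / 2 \<le> bumps k z" if "k < m" for k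
        proof -
          obtain y r where yr: "(y, r) \<in> F k" "z \<in> ball y r" using elim \<open>k < m\<close> by blast
          have "1 / 2 \<le> bump y r z" by (rule bump_ge[OF radius_pos[OF yr(1)] yr(2)])
          also have "\<dots> \<le> bumps k z"
            unfolding bumps_def
            using member_le_sum[OF yr(1), of "\<lambda>(y, r). bump y r z"]
            by (simp add: finite_cover case_prod_unfold bump_nonneg)
          finally show ?thesis .
        qed
        then have "(\<Sum>k<m. 1 / 2) \<le> (\<Sum>k<m. bumps k z)" by (intro sum_mono) simp
        with height_ge[OF False, of m] m' have "1 / e < height z" by simp
        with that have "inverse (height z) < inverse (1 / e)"
          by (intro less_imp_inverse_less) auto
        with that False show ?thesis by (simp add: damping_def)
      qed (use that in \<open>simp add: damping_def\<close>)
    qed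
  qed
  have "(damping \<longlongrightarrow> 0) (nhds x)"
    using small by (intro order_tendstoI) (auto intro: always_eventually less_le_trans[OF _ damping_nonneg])
  then have "(damping \<longlongrightarrow> 0) (at x)" by (rule tendsto_mono[rotated]) (simp add: at_within_le_nhds)
  with True show ?thesis by (simp add: isCont_def damping_def)
qed

text \<open>
  The ball of radius \<open>2 * r\<close> has volume \<open>2\<^sup>N v r\<^sup>N\<close>, where \<open>v\<close> is the volume of the unit ball, and the factor
  \<open>1 / r\<close> leaves the power that is controlled by the covers.
\<close>

lemma nn_integral_ball_density:
  "(\<integral>\<^sup>+x. ennreal (ball_density k x) \<partial>lebesgue)
    \<le> ennreal (2 ^ CARD('n) * unit_ball_vol (real CARD('n)) * (1 / 2) ^ k)"
proof -
  let ?v = "2 ^ CARD('n) * unit_ball_vol (real CARD('n))"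
  have card: "r ^ CARD('n) = r * r ^ (CARD('n) - 1)" for r :: real
    by (simp flip: power_Suc)
  have one: "(\<integral>\<^sup>+x. ennreal (1 / r * indicator (ball y (2 * r)) x) \<partial>lebesgue)
      = ennreal (?v * r ^ (CARD('n) - 1))" if "(y, r) \<in> F k" for y r
  proof -
    note r = radius_pos[OF that]
    have "(\<integral>\<^sup>+x. ennreal (1 / r * indicator (ball y (2 * r)) x) \<partial>lebesgue)
        = (\<integral>\<^sup>+x. ennreal (1 / r) * indicator (ball y (2 * r)) x \<partial>lebesgue)"
      by (intro nn_integral_cong) (auto simp: indicator_def)
    also have "\<dots> = ennreal (1 / r) * emeasure lebesgue (ball y (2 * r))"
      by (rule nn_integral_cmult_indicator) auto
    also have "emeasure lebesgue (ball y (2 * r)) = ennreal (unit_ball_vol (real CARD('n)) * (2 * r) ^ CARD('n))"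
      using emeasure_ball[of "2 * r" y] r by simp
    also have "ennreal (1 / r) * \<dots> = ennreal (1 / r * (unit_ball_vol (real CARD('n)) * (2 * r) ^ CARD('n)))"
      using r by (intro ennreal_mult[symmetric]) auto
    also have "1 / r * (unit_ball_vol (real CARD('n)) * (2 * r) ^ CARD('n)) = ?v * r ^ (CARD('n) - 1)"
      unfolding power_mult_distrib card[of r] using r by simp
    finally show ?thesis .
  qed
  have "(\<integral>\<^sup>+x. ennreal (ball_density k x) \<partial>lebesgue)
      = (\<integral>\<^sup>+x. (\<Sum>p\<in>F k. ennreal (1 / snd p * indicator (ball (fst p) (2 * snd p)) x)) \<partial>lebesgue)"
    unfolding ball_density_def case_prod_unfold
    by (intro nn_integral_cong sum_ennreal[symmetric]) (auto dest: radius_pos)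
  also have "\<dots> = (\<Sum>p\<in>F k. \<integral>\<^sup>+x. ennreal (1 / snd p * indicator (ball (fst p) (2 * snd p)) x) \<partial>lebesgue)"
    by (intro nn_integral_sum measurable_compose[OF _ measurable_ennreal] borel_measurable_times
        borel_measurable_const borel_measurable_indicator) simp
  also have "\<dots> = (\<Sum>p\<in>F k. ennreal (?v * snd p ^ (CARD('n) - 1)))"
    by (intro sum.cong refl) (use one in \<open>auto simp del: One_nat_def\<close>)
  also have "\<dots> = ennreal (?v * (\<Sum>(y, r)\<in>F k. r ^ (CARD('n) - 1)))"
    unfolding case_prod_unfold sum_distrib_left
    by (intro sum_ennreal) (auto dest!: radius_pos)
  also have "\<dots> \<le> ennreal (?v * (1 / 2) ^ k)"
    using sum_radius[of k] by (intro ennreal_leI mult_left_mono) auto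
  finally show ?thesis .
qed

lemma ball_density_measurable [measurable]: "ball_density k \<in> borel_measurable borel"
  unfolding ball_density_def[abs_def] case_prod_unfold
  by (intro borel_measurable_sum borel_measurable_times borel_measurable_const
      borel_measurable_indicator) simp

lemma integrable_majorant:
  assumes "\<Omega> \<in> sets lebesgue" "\<Omega> \<inter> K = {}"
  shows "integrable (lebesgue_on \<Omega>) majorant"
proof (rule integrableI_bounded)
  let ?v = "2 ^ CARD('n) * unit_ball_vol (real CARD('n))"
  have meas: "ball_density k \<in> borel_measurable (lebesgue_on \<Omega>)" for k
    by (intro measurable_restrict_space1 measurable_completion) simp
  then show "majorant \<in> borel_measurable (lebesgue_on \<Omega>)"
    unfolding majorant_def[abs_def] by (intro borel_measurable_suminf)
  have "(\<integral>\<^sup>+x. ennreal (norm (majorant x)) \<partial>lebesgue_on \<Omega>)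
      = (\<integral>\<^sup>+x. (\<Sum>k. ennreal (ball_density k x)) \<partial>lebesgue_on \<Omega>)"
  proof (rule nn_integral_cong)
    fix x assume "x \<in> space (lebesgue_on \<Omega>)"
    then have "x \<notin> K" using assms(2) by auto
    then show "ennreal (norm (majorant x)) = (\<Sum>k. ennreal (ball_density k x))"
      by (subst suminf_ennreal2[OF ball_density_nonneg summable_ball_density])
        (simp_all add: majorant_nonneg majorant_def[symmetric])
  qed
  also have "\<dots> = (\<Sum>k. \<integral>\<^sup>+x. ennreal (ball_density k x) \<partial>lebesgue_on \<Omega>)"
    by (intro nn_integral_suminf measurable_compose[OF meas measurable_ennreal])
  also have "\<dots> \<le> (\<Sum>k. ennreal (?v * (1 / 2) ^ k))"
  proof (intro suminf_le allI summableI)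
    fix k
    have "(\<integral>\<^sup>+x. ennreal (ball_density k x) \<partial>lebesgue_on \<Omega>)
        = (\<integral>\<^sup>+x. ennreal (ball_density k x) * indicator \<Omega> x \<partial>lebesgue)"
      using assms(1) by (intro nn_integral_restrict_space) simp
    also have "\<dots> \<le> (\<integral>\<^sup>+x. ennreal (ball_density k x) \<partial>lebesgue)"
      by (intro nn_integral_mono) (auto simp: indicator_def)
    also note nn_integral_ball_density
    finally show "(\<integral>\<^sup>+x. ennreal (ball_density k x) \<partial>lebesgue_on \<Omega>) \<le> ennreal (?v * (1 / 2) ^ k)" .
  qed
  also have "\<dots> = ennreal (\<Sum>k. ?v * (1 / 2) ^ k)"
    by (intro suminf_ennreal2 summable_mult summable_geometric) auto
  also have "\<dots> < \<infinity>" by simp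
  finally show "(\<integral>\<^sup>+x. ennreal (norm (majorant x)) \<partial>lebesgue_on \<Omega>) < \<infinity>" .
qed

end

section \<open>The Hessian of a damped function\<close>

text \<open>
  The algebra of \<open>h D\<^sup>2(\<zeta> / h)\<close> in the variables \<open>H = h\<close> and \<open>k = 1 / h\<close>.
\<close>

lemma cancel_factor:
  fixes H :: real
  assumes "H * k = 1"
  shows "H * (Z * (- k\<^sup>2 * A + 2 * k ^ 3 * P) + a * (- (k * k) * b) + c * (- (k * k) * d) + E * k)
    = Z * (- k * A) + Z * (2 * k\<^sup>2 * P) + a * (- k * b) + c * (- k * d) + E"
proof -
  have "H * (Z * (- k\<^sup>2 * A + 2 * k ^ 3 * P) + a * (- (k * k) * b) + c * (- (k * k) * d) + E * k)
    = (H * k) * (Z * (- k * A) + Z * (2 * k\<^sup>2 * P) + a * (- k * b) + c * (- k * d) + E)"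
    by (simp add: algebra_simps power2_eq_square power3_eq_cube)
  then show ?thesis by (simp only: assms mult_1_left)
qed

text \<open>
  Multiplied by \<open>h\<close>, the second derivative of \<open>\<zeta> / h\<close> is, up to signs, the sum of
  \<open>D\<^sup>2\<zeta>\<close>, two terms of the form
  \<open>D\<zeta> Dh / h\<close>, the term \<open>\<zeta> D\<^sup>2h / h\<close> and the term \<open>2 \<zeta> Dh Dh / h\<^sup>2\<close>.  As \<open>h \<ge> 1\<close>, the first three are
  controlled by the bounds on \<open>\<zeta>\<close> and \<open>|Dh| \<le> C \<Sum> 1/r\<close>.  In the last two the factor \<open>\<zeta> \<le> 2 L r\<close> on each
  ball turns \<open>1/r\<^sup>2\<close> into \<open>1/r\<close>, after the Cauchy-Schwarz inequality has replaced \<open>|Dh|\<^sup>2\<close> by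
  \<open>C h \<Sum> 1/r\<^sup>2\<close>.
\<close>

lemma damped_hessian_entry_bound:
  fixes y :: "'i \<Rightarrow> real^'n::finite" and r :: "'i \<Rightarrow> real" and I :: "'i set"
  defines "h \<equiv> \<lambda>z. 1 + (\<Sum>k\<in>I. bump (y k) (r k) z)"
  assumes I: "finite I" "\<And>k. k \<in> I \<Longrightarrow> 0 < r k"
    and U: "open U" "x \<in> U" "Ck_on 2 \<zeta> U"
    and bounds: "0 \<le> \<zeta> x" "\<And>k. k \<in> I \<Longrightarrow> \<zeta> x \<le> L * dist (y k) x" "0 \<le> L" "0 \<le> M"
      "\<And>i. \<bar>partial i \<zeta> x\<bar> \<le> M" "\<bar>partial i (partial j \<zeta>) x\<bar> \<le> M"
  shows "h x * \<bar>partial i (partial j (\<lambda>z. \<zeta> z * inverse (h z))) x\<bar>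
    \<le> M + (40 * M + 3600 * L) * (\<Sum>k\<in>I. 1 / r k * indicator (ball (y k) (2 * r k)) x)"
proof -
  define S where "S = (\<Sum>k\<in>I. 1 / r k * indicator (ball (y k) (2 * r k)) x)"
  have b: "Ck_on m (bump (y k) (r k)) UNIV" for m k by (intro Ck_on_bump open_UNIV)
  have h_pos: "1 \<le> h z" for z unfolding h_def by (auto intro!: sum_nonneg bump_nonneg)
  have h0: "h z \<noteq> 0" for z using h_pos[of z] by linarith
  have Ckh: "Ck_on m h UNIV" for m
    unfolding h_def by (intro Ck_on_add Ck_on_sum Ck_on_const b open_UNIV I)
  have dh: "partial i h z = (\<Sum>k\<in>I. partial i (bump (y k) (r k)) z)" for i z
    unfolding h_def using Ck_on_sum[OF open_UNIV I(1) b, of 1 "\<lambda>k. k"] b[of 1] I(1)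
    by (subst partial_add) (auto simp: partial_sum partial_eqI[OF has_derivative_const])
  have ddh: "partial i (partial j h) x = (\<Sum>k\<in>I. partial i (partial j (bump (y k) (r k))) x)"
  proof -
    have "partial j h = (\<lambda>z. \<Sum>k\<in>I. partial j (bump (y k) (r k)) z)" by (rule ext) (rule dh)
    then show ?thesis using b[of 2] I(1) by (simp add: partial_sum numeral_2_eq_2)
  qed
  have first: "\<bar>partial i h x\<bar> \<le> 20 * S" for i
  proof -
    have "\<bar>partial i h x\<bar> \<le> (\<Sum>k\<in>I. \<bar>partial i (bump (y k) (r k)) x\<bar>)" unfolding dh by (rule sum_abs)
    also have "\<dots> \<le> (\<Sum>k\<in>I. 20 / r k * indicator (ball (y k) (2 * r k)) x)"
      by (intro sum_mono partial_bump_bound_uniform I)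
    finally show ?thesis by (simp add: S_def sum_distrib_left)
  qed
  \<comment> \<open>bounding \<open>\<zeta>\<close> by the distance to the centre of a ball gains one power of its radius\<close>
  have near: "\<zeta> x * (1 / (r k)\<^sup>2 * indicator (ball (y k) (2 * r k)) x)
      \<le> 2 * L * (1 / r k * indicator (ball (y k) (2 * r k)) x)" if "k \<in> I" for k
  proof (cases "x \<in> ball (y k) (2 * r k)")
    case True
    have "L * dist (y k) x \<le> L * (2 * r k)" using True bounds(3) by (intro mult_left_mono) auto
    with bounds(2)[OF that] have "\<zeta> x \<le> L * (2 * r k)" by linarith
    then have "\<zeta> x * (1 / (r k)\<^sup>2) \<le> L * (2 * r k) * (1 / (r k)\<^sup>2)"
      by (intro mult_right_mono) auto
    then show ?thesis using True I(2)[OF that] by (simp add: power2_eq_square mult.commute)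
  qed simp
  let ?R = "\<Sum>k\<in>I. 1 / (r k)\<^sup>2 * indicator (ball (y k) (2 * r k)) x"
  have R: "\<zeta> x * ?R \<le> 2 * L * S"
    unfolding S_def sum_distrib_left by (intro sum_mono near)
  have R_nonneg: "0 \<le> ?R" by (intro sum_nonneg) auto
  have S_nonneg: "0 \<le> S" unfolding S_def using I(2) by (fastforce intro!: sum_nonneg)
  have second: "\<zeta> x * \<bar>partial i (partial j h) x\<bar> \<le> 2000 * L * S"
  proof -
    have "\<bar>partial i (partial j h) x\<bar> \<le> (\<Sum>k\<in>I. \<bar>partial i (partial j (bump (y k) (r k))) x\<bar>)"
      unfolding ddh by (rule sum_abs)
    also have "\<dots> \<le> (\<Sum>k\<in>I. 1000 / (r k)\<^sup>2 * indicator (ball (y k) (2 * r k)) x)"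
      by (intro sum_mono second_partial_bump_bound I)
    also have "\<dots> = 1000 * ?R" by (simp add: sum_distrib_left)
    finally have "\<zeta> x * \<bar>partial i (partial j h) x\<bar> \<le> \<zeta> x * (1000 * ?R)"
      by (intro mult_left_mono bounds(1))
    with R show ?thesis by linarith
  qed
  \<comment> \<open>the bounds on the single bumps are products of a factor summing to at most \<open>h\<close> and one summing to \<open>?R\<close>\<close>
  have sqrt_bound: "\<bar>partial i h x\<bar> \<le> sqrt (400 * h x * ?R)" for i
  proof -
    let ?a = "\<lambda>k. sqrt (bump (y k) (r k) x)" and ?b = "\<lambda>k. 20 / r k * indicator (ball (y k) (2 * r k)) x"
    have "\<bar>partial i h x\<bar> \<le> (\<Sum>k\<in>I. \<bar>partial i (bump (y k) (r k)) x\<bar>)" unfolding dh by (rule sum_abs)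
    also have "\<dots> \<le> (\<Sum>k\<in>I. ?a k * ?b k)"
      by (intro sum_mono partial_bump_bound I)
    finally have "\<bar>partial i h x\<bar>\<^sup>2 \<le> (\<Sum>k\<in>I. ?a k * ?b k)\<^sup>2"
      by (intro power_mono) auto
    also have "\<dots> \<le> (\<Sum>k\<in>I. (?a k)\<^sup>2) * (\<Sum>k\<in>I. (?b k)\<^sup>2)"
      by (rule Cauchy_Schwarz_ineq_sum)
    also have "(\<Sum>k\<in>I. (?a k)\<^sup>2) = h x - 1" by (simp add: h_def bump_nonneg)
    also have "(\<Sum>k\<in>I. (?b k)\<^sup>2) = 400 * ?R"
      by (auto simp: sum_distrib_left power_mult_distrib power_divide indicator_def intro!: sum.cong)
    also have "(h x - 1) * (400 * ?R) \<le> h x * (400 * ?R)"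
      using R_nonneg by (intro mult_right_mono) auto
    finally show ?thesis by (intro real_le_rsqrt) (simp add: ac_simps)
  qed
  have cross: "\<zeta> x * \<bar>partial i h x * partial j h x\<bar> \<le> 800 * L * S * h x"
  proof -
    have nn: "0 \<le> 400 * h x * ?R" using R_nonneg h_pos[of x] by simp
    have "\<bar>partial i h x * partial j h x\<bar> \<le> sqrt (400 * h x * ?R) * sqrt (400 * h x * ?R)"
      unfolding abs_mult using nn by (intro mult_mono sqrt_bound) auto
    also have "\<dots> = 400 * h x * ?R" using nn by simp
    finally have "\<zeta> x * \<bar>partial i h x * partial j h x\<bar> \<le> \<zeta> x * (400 * h x * ?R)"
      by (intro mult_left_mono bounds(1))
    also have "\<dots> = 400 * h x * (\<zeta> x * ?R)" by simp
    also have "\<dots> \<le> 400 * h x * (2 * L * S)"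
      using h_pos[of x] by (intro mult_left_mono R) auto
    finally show ?thesis by (simp add: ac_simps)
  qed
  define k where "k = inverse (h x)"
  have k: "0 \<le> k" "k \<le> 1" "h x * k = 1"
    using h_pos[of x] h0[of x] by (auto simp: k_def inverse_le_1_iff)
  let ?D = "partial i (partial j (\<lambda>z. \<zeta> z * inverse (h z))) x"
  have CkU: "Ck_on 2 h U" "Ck_on 2 (\<lambda>z. inverse (h z)) U"
    using Ckh h0 U(1) by (auto intro!: Ck_on_inverse intro: Ck_on_subset)
  have hd: "h differentiable (at x)" using Ckh[of 1] by simp
  have "?D = \<zeta> x * (- k\<^sup>2 * partial i (partial j h) x + 2 * k ^ 3 * (partial i h x * partial j h x))
      + partial i \<zeta> x * (- (k * k) * partial j h x) + partial j \<zeta> x * (- (k * k) * partial i h x)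
      + partial i (partial j \<zeta>) x * k"
    unfolding second_partial_mult[OF U CkU(2)] second_partial_inverse[OF U(1,2) CkU(1) h0]
      partial_inverse(1)[OF hd h0] k_def by (rule refl)
  then have eq: "h x * ?D = \<zeta> x * (- k * partial i (partial j h) x)
      + \<zeta> x * (2 * k\<^sup>2 * (partial i h x * partial j h x))
      + partial i \<zeta> x * (- k * partial j h x) + partial j \<zeta> x * (- k * partial i h x)
      + partial i (partial j \<zeta>) x"
    by (simp only: cancel_factor[OF k(3)])
  have t1: "\<bar>\<zeta> x * (- k * partial i (partial j h) x)\<bar> \<le> 2000 * L * S"
  proof -
    have "\<bar>\<zeta> x * (- k * partial i (partial j h) x)\<bar> = k * (\<zeta> x * \<bar>partial i (partial j h) x\<bar>)"
      using k bounds(1) by (simp add: abs_mult)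
    also have "\<dots> \<le> 1 * (2000 * L * S)"
      using k bounds(1) by (intro mult_mono second) auto
    finally show ?thesis by simp
  qed
  have t2: "\<bar>\<zeta> x * (2 * k\<^sup>2 * (partial i h x * partial j h x))\<bar> \<le> 1600 * L * S"
  proof -
    have "\<bar>\<zeta> x * (2 * k\<^sup>2 * (partial i h x * partial j h x))\<bar>
        = 2 * k\<^sup>2 * (\<zeta> x * \<bar>partial i h x * partial j h x\<bar>)"
      using bounds(1) by (simp add: abs_mult)
    also have "\<dots> \<le> 2 * k\<^sup>2 * (800 * L * S * h x)"
      by (intro mult_left_mono cross) auto
    also have "\<dots> = k * (1600 * L * S) * (h x * k)" by (simp add: power2_eq_square)
    also have "\<dots> \<le> 1 * (1600 * L * S)"
      using k bounds(3) S_nonneg by (simp add: mult_left_le_one_le)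
    finally show ?thesis by simp
  qed
  have t3: "\<bar>partial i \<zeta> x * (- k * partial j h x)\<bar> \<le> 20 * M * S" for i j
  proof -
    have "\<bar>partial i \<zeta> x * (- k * partial j h x)\<bar> = \<bar>partial i \<zeta> x\<bar> * (k * \<bar>partial j h x\<bar>)"
      using k by (simp add: abs_mult)
    also have "\<dots> \<le> M * (1 * (20 * S))"
      using k bounds(4) by (intro mult_mono bounds(5) first) auto
    finally show ?thesis by simp
  qed
  have "h x * \<bar>?D\<bar> = \<bar>h x * ?D\<bar>" using h_pos[of x] by (simp add: abs_mult)
  also have "\<dots> \<le> 2000 * L * S + 1600 * L * S + 20 * M * S + 20 * M * S + M"
    unfolding eq by (intro order_trans[OF abs_triangle_ineq] add_mono t1 t2 t3 bounds(6))
  also have "\<dots> = M + (40 * M + 3600 * L) * S" by (simp add: algebra_simps)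
  finally show ?thesis by (simp add: S_def)
qed

section \<open>Functions that are smooth up to the boundary\<close>

lemma locally_bounded_imp_bounded:
  assumes "compact S" "\<And>p. p \<in> S \<Longrightarrow> \<exists>U B. open U \<and> p \<in> U \<and> (\<forall>x\<in>U \<inter> T. f x \<le> (B :: real))"
  shows "\<exists>B. \<forall>x\<in>S \<inter> T. f x \<le> B"
proof -
  let ?C = "{U. open U \<and> (\<exists>B. \<forall>x\<in>U \<inter> T. f x \<le> B)}"
  have "S \<subseteq> \<Union>?C"
  proof
    fix p assume "p \<in> S"
    from assms(2)[OF this] show "p \<in> \<Union>?C" by blast
  qed
  then obtain C where C: "C \<subseteq> ?C" "finite C" "S \<subseteq> \<Union>C"
    by (rule compactE[OF assms(1)]) blast
  from C(1) have "\<forall>U\<in>C. \<exists>B. \<forall>x\<in>U \<inter> T. f x \<le> B" by blast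
  from bchoice[OF this] obtain B where B: "\<forall>U\<in>C. \<forall>x\<in>U \<inter> T. f x \<le> B U" ..
  have "f x \<le> Max (insert 0 (B ` C))" if x: "x \<in> S \<inter> T" for x
  proof -
    obtain U where U: "U \<in> C" "x \<in> U" using C(3) x by blast
    then have "f x \<le> B U" using B x by blast
    also have "\<dots> \<le> Max (insert 0 (B ` C))" using U C(2) by (intro Max_ge) auto
    finally show ?thesis .
  qed
  then show ?thesis by blast
qed

text \<open>
  Near a point of the closure the derivatives are those of a function smooth in a full
  neighbourhood, hence bounded; compactness of the closure makes the bound uniform.
\<close>

lemma smooth_on_closure_bounded_derivatives:
  fixes f :: "real^'n::finite \<Rightarrow> real"
  assumes "open \<Omega>" "bounded \<Omega>" "smooth_on (closure \<Omega>) f"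
  obtains M where "0 \<le> M" "\<And>x i. x \<in> \<Omega> \<Longrightarrow> \<bar>partial i f x\<bar> \<le> M"
    "\<And>x i j. x \<in> \<Omega> \<Longrightarrow> \<bar>partial i (partial j f) x\<bar> \<le> M"
proof -
  let ?S = "\<lambda>f x. (\<Sum>i\<in>UNIV. \<bar>partial i f x\<bar>) + (\<Sum>i\<in>UNIV. \<Sum>j\<in>UNIV. \<bar>partial i (partial j f) x\<bar>)"
  have "\<exists>B. \<forall>x\<in>closure \<Omega> \<inter> \<Omega>. ?S f x \<le> B"
  proof (rule locally_bounded_imp_bounded)
    show "compact (closure \<Omega>)" using assms(2) by (simp add: compact_closure)
  next
    fix p assume "p \<in> closure \<Omega>"
    then obtain U g where U: "open U" "p \<in> U" "Ck_on 2 g U" "\<forall>y\<in>U \<inter> closure \<Omega>. g y = f y"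
      using assms(3) unfolding smooth_on_def by blast
    have "Ck_on 1 g U" using U(3) Ck_on_Suc_imp[of 1 g U] by (simp only: numeral_2_eq_2 One_nat_def)
    then have "continuous_on U (partial i g)" for i by simp
    moreover have "continuous_on U (partial i (partial j g))" for i j
      using U(3) by (simp add: numeral_2_eq_2)
    ultimately have "continuous_on U (?S g)"
      by (intro continuous_on_add continuous_on_sum continuous_on_rabs)
    then have "isCont (?S g) p" using U by (simp add: continuous_on_eq_continuous_at)
    then have "(?S g \<longlongrightarrow> ?S g p) (nhds p)"
      unfolding isCont_def by (rule tendsto_at_iff_tendsto_nhds[THEN iffD1])
    then have "\<forall>\<^sub>F x in nhds p. ?S g x < ?S g p + 1"
      by (rule order_tendstoD(2)) simp
    then obtain W where W: "open W" "p \<in> W" "\<And>x. x \<in> W \<Longrightarrow> ?S g x < ?S g p + 1"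
      unfolding eventually_nhds by blast
    have le: "?S f x \<le> ?S g p + 1" if "x \<in> (U \<inter> W) \<inter> \<Omega>" for x
    proof -
      have o: "open (U \<inter> \<Omega>)" using U(1) assms(1) by blast
      have xU: "x \<in> U \<inter> \<Omega>" using that by blast
      have e: "f z = g z" if "z \<in> U \<inter> \<Omega>" for z
      proof -
        have "z \<in> U \<inter> closure \<Omega>" using that closure_subset by blast
        then show ?thesis by (rule bspec[OF U(4), symmetric])
      qed
      have d: "partial i f z = partial i g z" if "z \<in> U \<inter> \<Omega>" for i z
        by (rule partial_cong[OF o that e])
      have "partial i (partial j f) x = partial i (partial j g) x" for i j
        by (rule partial_cong[OF o xU d])
      then have eq: "?S f x = ?S g x" by (simp only: d[OF xU])
      have "x \<in> W" using that by blast
      then show ?thesis unfolding eq by (rule less_imp_le[OF W(3)])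
    qed
    show "\<exists>V B. open V \<and> p \<in> V \<and> (\<forall>x\<in>V \<inter> \<Omega>. ?S f x \<le> B)"
      by (intro exI[of _ "U \<inter> W"] exI[of _ "?S g p + 1"] conjI ballI le open_Int U(1) W(1) IntI U(2) W(2)) auto
  qed
  then obtain B where "\<forall>x\<in>closure \<Omega> \<inter> \<Omega>. ?S f x \<le> B" ..
  then have B: "?S f x \<le> B" if "x \<in> \<Omega>" for x
    using that closure_subset by blast
  show thesis
  proof (rule that[of "max 0 B"])
    fix x i j assume x: "x \<in> \<Omega>"
    define a where "a = (\<Sum>i\<in>UNIV. \<bar>partial i f x\<bar>)"
    define b where "b i = (\<Sum>j\<in>UNIV. \<bar>partial i (partial j f) x\<bar>)" for i
    have "\<bar>partial i f x\<bar> \<le> a"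
      unfolding a_def by (rule member_le_sum[of i UNIV "\<lambda>i. \<bar>partial i f x\<bar>"]) simp_all
    moreover have "\<bar>partial i (partial j f) x\<bar> \<le> b i"
      unfolding b_def by (rule member_le_sum[of j UNIV "\<lambda>j. \<bar>partial i (partial j f) x\<bar>"]) simp_all
    moreover have b0: "0 \<le> b i" for i unfolding b_def by (rule sum_nonneg) simp
    moreover have "b i \<le> sum b UNIV" by (rule member_le_sum[of i UNIV b]) (simp_all add: b0)
    moreover have "0 \<le> a" unfolding a_def by (rule sum_nonneg) simp
    moreover have "a + sum b UNIV \<le> max 0 B" using B[OF x] by (simp add: a_def b_def[abs_def] max_def)
    ultimately show "\<bar>partial i f x\<bar> \<le> max 0 B" "\<bar>partial i (partial j f) x\<bar> \<le> max 0 B"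
      using b0[of i] by linarith+
  qed simp
qed

text \<open>
  The domain need not be convex, so the segment from \<open>x\<close> to \<open>y\<close> may leave it.  The segment from \<open>x\<close> to
  a nearest boundary point \<open>z\<close> does not, except at its end, and it is no longer; the mean value theorem
  on it gives the bound.
\<close>

lemma boundary_distance_bound:
  fixes f :: "real^'n::finite \<Rightarrow> real"
  assumes "open \<Omega>" "continuous_on (closure \<Omega>) f" "\<And>x. x \<in> frontier \<Omega> \<Longrightarrow> f x = 0"
    and "\<And>x. x \<in> \<Omega> \<Longrightarrow> f differentiable (at x)" "\<And>x i. x \<in> \<Omega> \<Longrightarrow> \<bar>partial i f x\<bar> \<le> M"
    and "x \<in> \<Omega>" "y \<in> frontier \<Omega>"
  shows "\<bar>f x\<bar> \<le> (real CARD('n) * M) * dist y x"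
proof -
  have "frontier \<Omega> \<noteq> {}" "closed (frontier \<Omega>)" using assms(7) by auto
  from this(2,1) obtain z where z: "z \<in> frontier \<Omega>" "\<And>w. w \<in> frontier \<Omega> \<Longrightarrow> dist x z \<le> dist x w"
    by (rule distance_attains_inf[of "frontier \<Omega>" x]) blast
  have "x \<notin> frontier \<Omega>" using assms(1,6) by (simp add: frontier_def interior_open)
  then have xz: "x \<noteq> z" using z(1) by auto
  have ball: "ball x (dist x z) \<subseteq> \<Omega>"
  proof (rule ccontr)
    assume "\<not> ?thesis"
    then have "ball x (dist x z) - \<Omega> \<noteq> {}" by blast
    moreover have "x \<in> ball x (dist x z) \<inter> \<Omega>" using assms(6) xz by simp
    ultimately have "ball x (dist x z) \<inter> frontier \<Omega> \<noteq> {}"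
      by (intro connected_Int_frontier) blast+
    then obtain w where "w \<in> frontier \<Omega>" "dist x w < dist x z" by auto
    with z(2)[of w] show False by linarith
  qed
  define g where "g t = f (x + t *\<^sub>R (z - x))" for t
  have seg: "x + t *\<^sub>R (z - x) \<in> \<Omega>" if "0 \<le> t" "t < 1" for t
  proof -
    have "dist x (x + t *\<^sub>R (z - x)) = t * dist x z"
      using that by (simp add: dist_norm norm_minus_commute)
    also have "\<dots> < 1 * dist x z" using that xz by (intro mult_strict_right_mono) auto
    finally show ?thesis using ball by auto
  qed
  have "x + t *\<^sub>R (z - x) \<in> closure \<Omega>" if "t \<in> {0..1}" for t
  proof (cases "t = 1")
    case True
    then show ?thesis using z(1) by (simp add: frontier_def)
  next
    case False
    then show ?thesis using seg[of t] that closure_subset by auto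
  qed
  then have "continuous_on {0..1} g"
    unfolding g_def[abs_def] by (intro continuous_on_compose2[OF assms(2)] continuous_intros) auto
  moreover have "(g has_derivative (\<lambda>s. s * ((z - x) \<bullet> (\<chi> i. partial i f (x + t *\<^sub>R (z - x)))))) (at t)"
    if "0 < t" "t < 1" for t
  proof -
    have "((\<lambda>t. x + t *\<^sub>R (z - x)) has_derivative (\<lambda>s. s *\<^sub>R (z - x))) (at t)"
      by (auto intro!: derivative_eq_intros)
    from has_derivative_compose[OF this has_derivative_partials[OF assms(4)[OF seg]]] that
    show ?thesis unfolding g_def by simp
  qed
  ultimately obtain t where t: "0 < t" "t < 1"
      "g 1 - g 0 = (z - x) \<bullet> (\<chi> i. partial i f (x + t *\<^sub>R (z - x)))"
    using mvt[of 0 1 g "\<lambda>t s. s * ((z - x) \<bullet> (\<chi> i. partial i f (x + t *\<^sub>R (z - x))))"] by auto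
  let ?G = "\<chi> i. partial i f (x + t *\<^sub>R (z - x))"
  have "norm ?G \<le> (\<Sum>i\<in>UNIV. \<bar>?G $ i\<bar>)" by (rule norm_le_l1_cart)
  also have "\<dots> \<le> (\<Sum>i\<in>(UNIV :: 'n set). M)" using assms(5)[OF seg] t by (intro sum_mono) simp
  finally have G: "norm ?G \<le> real CARD('n) * M" by simp
  have "\<bar>f x\<bar> = \<bar>(z - x) \<bullet> ?G\<bar>" using t(3) assms(3)[OF z(1)] by (simp add: g_def)
  also have "\<dots> \<le> norm (z - x) * norm ?G" by (rule Cauchy_Schwarz_ineq2)
  also have "\<dots> \<le> dist y x * (real CARD('n) * M)"
    using z(2)[OF assms(7)] G by (intro mult_mono) (auto simp: dist_norm norm_minus_commute)
  finally show ?thesis by (simp add: mult.commute)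
qed

section \<open>The outward unit normal\<close>

text \<open>
  The gradient of \<open>graph_fun e \<gamma>\<close>: the chain rule for the orthogonal projection along \<open>e\<close> subtracts
  from \<open>e\<close> the tangential part of the gradient \<open>G\<close> of \<open>\<gamma>\<close>.
\<close>

definition graph_gradient :: "real^'n::finite \<Rightarrow> (real^'n \<Rightarrow> real) \<Rightarrow> real^'n \<Rightarrow> real^'n" where
  "graph_gradient e \<gamma> x =
     (let G = (\<chi> i. partial i \<gamma> (x - (x \<bullet> e) *\<^sub>R e)) in e - (G - (G \<bullet> e) *\<^sub>R e))"

text \<open>
  In particular the gradient does not vanish, so that it can be normalised.
\<close>

lemma graph_gradient_inner: "norm e = 1 \<Longrightarrow> graph_gradient e \<gamma> x \<bullet> e = 1"
  by (simp add: graph_gradient_def Let_def inner_diff_left norm_eq_1)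

lemma graph_gradient_nonzero: "norm e = 1 \<Longrightarrow> graph_gradient e \<gamma> x \<noteq> 0"
  using graph_gradient_inner[of e \<gamma> x] by auto

lemma graph_fun_gderiv:
  fixes \<gamma> :: "real^'n::finite \<Rightarrow> real"
  assumes "smooth_on UNIV \<gamma>"
  shows "GDERIV (graph_fun e \<gamma>) x :> graph_gradient e \<gamma> x"
proof -
  let ?P = "\<lambda>x::real^'n. x - (x \<bullet> e) *\<^sub>R e"
  let ?G = "\<chi> i. partial i \<gamma> (?P x)"
  have "\<gamma> differentiable (at (?P x))"
    using smooth_on_open_imp_Ck_on[OF open_UNIV assms, of 1] by simp
  then have G: "(\<gamma> has_derivative (\<lambda>h. h \<bullet> ?G)) (at (?P x))" by (rule has_derivative_partials)
  have "(?P has_derivative ?P) (at x)" by (auto intro!: derivative_eq_intros)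
  from has_derivative_compose[OF this G]
  have "((\<lambda>x. \<gamma> (?P x)) has_derivative (\<lambda>h. ?P h \<bullet> ?G)) (at x)" .
  then have "(graph_fun e \<gamma> has_derivative (\<lambda>h. h \<bullet> e - ?P h \<bullet> ?G)) (at x)"
    unfolding graph_fun_def[abs_def] by (auto intro!: derivative_eq_intros)
  moreover have "h \<bullet> e - ?P h \<bullet> ?G = h \<bullet> graph_gradient e \<gamma> x" for h
    by (simp add: graph_gradient_def Let_def inner_diff_left inner_diff_right inner_commute algebra_simps)
  ultimately show ?thesis unfolding gderiv_def by simp
qed

lemma continuous_on_graph_gradient:
  fixes \<gamma> :: "real^'n::finite \<Rightarrow> real"
  assumes "smooth_on UNIV \<gamma>"
  shows "continuous_on S (graph_gradient e \<gamma>)"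
proof -
  have "continuous_on UNIV (partial i \<gamma>)" for i
    using smooth_on_open_imp_Ck_on[OF open_UNIV assms, of 1] by simp
  then have "continuous_on S (\<lambda>x. partial i \<gamma> (x - (x \<bullet> e) *\<^sub>R e))" for i
    by (rule continuous_on_compose2) (auto intro!: continuous_intros)
  then show ?thesis
    unfolding graph_gradient_def[abs_def] Let_def by (intro continuous_intros)
qed

lemma graph_fun_eq_0_frontier:
  assumes "open \<Omega>" "local_graph \<Omega> x r e \<gamma>" "y \<in> frontier \<Omega>" "y \<in> ball x r"
  shows "graph_fun e \<gamma> y = 0"
proof -
  have \<gamma>: "smooth_on UNIV \<gamma>" and eq: "\<Omega> \<inter> ball x r = {y \<in> ball x r. graph_fun e \<gamma> y < 0}"
    using assms(2) by (auto simp: local_graph_def)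
  have cont: "continuous_on UNIV (graph_fun e \<gamma>)"
    using graph_fun_gderiv[OF \<gamma>] unfolding gderiv_def
    by (auto intro!: continuous_at_imp_continuous_on has_derivative_continuous)
  have "y \<notin> \<Omega>" using assms(1,3) by (simp add: frontier_def interior_open)
  with eq assms(4) have "\<not> graph_fun e \<gamma> y < 0" by auto
  moreover have False if "graph_fun e \<gamma> y > 0"
  proof -
    have "open (ball x r \<inter> {z. graph_fun e \<gamma> z > 0})"
      by (intro open_Int open_ball open_Collect_less continuous_on_const cont)
    moreover have "y \<in> ball x r \<inter> {z. graph_fun e \<gamma> z > 0}" using that assms(4) by simp
    ultimately have "\<Omega> \<inter> (ball x r \<inter> {z. graph_fun e \<gamma> z > 0}) \<noteq> {}"
      using assms(3) open_Int_closure_eq_empty[of "ball x r \<inter> {z. graph_fun e \<gamma> z > 0}" \<Omega>]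
      unfolding frontier_def by blast
    then obtain z where z: "z \<in> \<Omega> \<inter> ball x r" "graph_fun e \<gamma> z > 0" by blast
    then show False unfolding eq by simp
  qed
  ultimately show ?thesis by (metis linorder_neqE_linordered_idom)
qed

lemma local_graph_recentre:
  assumes "local_graph \<Omega> x r e \<gamma>" "y \<in> ball x r"
  shows "local_graph \<Omega> y (r - dist x y) e \<gamma>"
proof -
  have "ball y (r - dist x y) \<subseteq> ball x r"
  proof
    fix z assume "z \<in> ball y (r - dist x y)"
    then show "z \<in> ball x r" using dist_triangle[of x z y] by simp
  qed
  then have "\<Omega> \<inter> ball y (r - dist x y) = (\<Omega> \<inter> ball x r) \<inter> ball y (r - dist x y)"
      and "{z \<in> ball y (r - dist x y). graph_fun e \<gamma> z < 0}
        = {z \<in> ball x r. graph_fun e \<gamma> z < 0} \<inter> ball y (r - dist x y)"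
    by blast+
  then show ?thesis using assms by (simp add: local_graph_def)
qed

lemma gderiv_along_line:
  assumes "GDERIV f x :> w"
  shows "((\<lambda>t. f (x + t *\<^sub>R v)) has_real_derivative v \<bullet> w) (at 0)"
proof -
  have "((\<lambda>t. x + t *\<^sub>R v) has_derivative (\<lambda>t. t *\<^sub>R v)) (at 0)"
    by (auto intro!: derivative_eq_intros)
  from has_derivative_compose[OF this, of f "\<lambda>h. h \<bullet> w"] assms
  have "((\<lambda>t. f (x + t *\<^sub>R v)) has_derivative (\<lambda>t. t *\<^sub>R v \<bullet> w)) (at 0)"
    by (simp add: gderiv_def)
  moreover have "(\<lambda>t. t *\<^sub>R v \<bullet> w) = (*) (v \<bullet> w)" by (rule ext) simp
  ultimately show ?thesis by (simp add: has_field_derivative_def)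
qed

lemma eventually_line_in_open:
  fixes x v :: "'a::real_normed_vector"
  assumes "open U" "x \<in> U"
  shows "\<forall>\<^sub>F t in at 0 within S. x + t *\<^sub>R v \<in> U"
proof -
  have "((\<lambda>t. x + t *\<^sub>R v) \<longlongrightarrow> x + 0 *\<^sub>R v) (at 0 within S)" by (intro tendsto_intros)
  with assms show ?thesis by (simp add: tendsto_def)
qed

lemma local_graph_enter:
  assumes "open \<Omega>" "local_graph \<Omega> x r e \<gamma>" "x \<in> frontier \<Omega>"
    and "GDERIV (graph_fun e \<gamma>) x :> w" "v \<bullet> w < 0"
  shows "\<forall>\<^sub>F t in at_right 0. x + t *\<^sub>R v \<in> \<Omega>"
proof -
  have r: "0 < r" and eq: "\<Omega> \<inter> ball x r = {y \<in> ball x r. graph_fun e \<gamma> y < 0}"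
    using assms(2) by (auto simp: local_graph_def)
  have 0: "graph_fun e \<gamma> x = 0" using graph_fun_eq_0_frontier[OF assms(1-3)] r by simp
  obtain d where "0 < d" "\<And>h. 0 < h \<Longrightarrow> h < d \<Longrightarrow> graph_fun e \<gamma> (x + h *\<^sub>R v) < 0"
    using DERIV_neg_dec_right[OF gderiv_along_line[OF assms(4)] assms(5)] 0 by auto
  then have "\<forall>\<^sub>F t in at_right 0. graph_fun e \<gamma> (x + t *\<^sub>R v) < 0"
    unfolding eventually_at_right_field by (intro exI[of _ d]) auto
  moreover have "\<forall>\<^sub>F t in at_right 0. x + t *\<^sub>R v \<in> ball x r"
    by (rule eventually_line_in_open) (use r in auto)
  ultimately show ?thesis
  proof eventually_elim
    case (elim t)
    then have "x + t *\<^sub>R v \<in> {y \<in> ball x r. graph_fun e \<gamma> y < 0}" by blast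
    then show ?case unfolding eq[symmetric] by blast
  qed
qed

lemma local_graph_exit:
  assumes "open \<Omega>" "local_graph \<Omega> x r e \<gamma>" "x \<in> frontier \<Omega>"
    and "GDERIV (graph_fun e \<gamma>) x :> w" "v \<bullet> w > 0"
  shows "\<forall>\<^sub>F t in at_right 0. x + t *\<^sub>R v \<notin> \<Omega>"
proof -
  have r: "0 < r" and eq: "\<Omega> \<inter> ball x r = {y \<in> ball x r. graph_fun e \<gamma> y < 0}"
    using assms(2) by (auto simp: local_graph_def)
  have 0: "graph_fun e \<gamma> x = 0" using graph_fun_eq_0_frontier[OF assms(1-3)] r by simp
  obtain d where "0 < d" "\<And>h. 0 < h \<Longrightarrow> h < d \<Longrightarrow> graph_fun e \<gamma> (x + h *\<^sub>R v) > 0"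
    using DERIV_pos_inc_right[OF gderiv_along_line[OF assms(4)] assms(5)] 0 by auto
  then have "\<forall>\<^sub>F t in at_right 0. graph_fun e \<gamma> (x + t *\<^sub>R v) > 0"
    unfolding eventually_at_right_field by (intro exI[of _ d]) auto
  moreover have "\<forall>\<^sub>F t in at_right 0. x + t *\<^sub>R v \<in> ball x r"
    by (rule eventually_line_in_open) (use r in auto)
  ultimately show ?thesis
  proof eventually_elim
    case (elim t)
    show ?case
    proof
      assume "x + t *\<^sub>R v \<in> \<Omega>"
      with elim have "x + t *\<^sub>R v \<in> \<Omega> \<inter> ball x r" by blast
      then show False unfolding eq using elim by simp
    qed
  qed
qed

text \<open>
  If the two unit vectors differed, their difference would be a direction that enters the domain
  according to one graph and leaves it according to the other.
\<close>

lemma local_graph_normal_unique: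
  assumes "open \<Omega>" "x \<in> frontier \<Omega>"
    and "local_graph \<Omega> x r e \<gamma>" "GDERIV (graph_fun e \<gamma>) x :> w" "w \<noteq> 0"
    and "local_graph \<Omega> x r' e' \<gamma>'" "GDERIV (graph_fun e' \<gamma>') x :> w'" "w' \<noteq> 0"
  shows "sgn w = sgn w'"
proof (rule ccontr)
  assume ne: "sgn w \<noteq> sgn w'"
  have unit: "norm (sgn w) = 1" "norm (sgn w') = 1" using assms(5,8) by (simp_all add: norm_sgn)
  have "0 < (norm (sgn w - sgn w'))\<^sup>2" using ne by simp
  also have "\<dots> = 2 - 2 * (sgn w \<bullet> sgn w')"
    using unit by (simp add: power2_norm_eq_inner inner_diff_left inner_diff_right inner_commute norm_eq_1)
  finally have less: "sgn w \<bullet> sgn w' < 1" by simp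
  define v where "v = sgn w' - sgn w"
  have "v \<bullet> sgn w < 0" "v \<bullet> sgn w' > 0"
    using less unit by (simp_all add: v_def inner_diff_left norm_eq_1 inner_commute[of "sgn w'" "sgn w"])
  then have "v \<bullet> w < 0" "v \<bullet> w' > 0"
    using assms(5,8) by (simp_all add: sgn_div_norm mult_less_0_iff zero_less_mult_iff)
  from local_graph_enter[OF assms(1,3,2,4) this(1)] local_graph_exit[OF assms(1,6,2,7) this(2)]
  have "\<forall>\<^sub>F t::real in at_right 0. False" by eventually_elim simp
  then show False by simp
qed

text \<open>
  One local graph describes the normal at all nearby boundary points, not only at its centre, whence
  the continuity of the normal along the boundary.
\<close>

lemma outward_normal_eq:
  assumes "open \<Omega>" "local_graph \<Omega> x r e \<gamma>" "y \<in> frontier \<Omega>" "y \<in> ball x r"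
  shows "outward_normal \<Omega> y = sgn (graph_gradient e \<gamma> y)"
proof -
  note lg = local_graph_recentre[OF assms(2,4)]
  have e: "norm e = 1" and \<gamma>: "smooth_on UNIV \<gamma>"
    using assms(2) by (auto simp: local_graph_def)
  show ?thesis
    unfolding outward_normal_def
  proof (rule the_equality)
    show "\<exists>r' e' \<gamma>' w. local_graph \<Omega> y r' e' \<gamma>' \<and> GDERIV (graph_fun e' \<gamma>') y :> w
        \<and> sgn (graph_gradient e \<gamma> y) = sgn w"
      using lg graph_fun_gderiv[OF \<gamma>] by blast
  next
    fix \<nu> assume "\<exists>r' e' \<gamma>' w. local_graph \<Omega> y r' e' \<gamma>' \<and> GDERIV (graph_fun e' \<gamma>') y :> w \<and> \<nu> = sgn w"
    then obtain r' e' \<gamma>' w where *: "local_graph \<Omega> y r' e' \<gamma>'" "GDERIV (graph_fun e' \<gamma>') y :> w" "\<nu> = sgn w"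
      by blast
    have "w = graph_gradient e' \<gamma>' y"
    proof -
      have "(\<lambda>h. h \<bullet> w) = (\<lambda>h. h \<bullet> graph_gradient e' \<gamma>' y)"
        using *(1,2) graph_fun_gderiv[of \<gamma>' e' y] unfolding gderiv_def local_graph_def
        by (blast intro: has_derivative_unique)
      then show ?thesis by (metis inner_commute vector_eq_rdot)
    qed
    moreover have "norm e' = 1" using *(1) by (simp add: local_graph_def)
    ultimately have "w \<noteq> 0" by (simp add: graph_gradient_nonzero)
    then show "\<nu> = sgn (graph_gradient e \<gamma> y)"
      unfolding *(3)
      by (rule local_graph_normal_unique[OF assms(1,3) *(1,2) _ lg graph_fun_gderiv[OF \<gamma>]
            graph_gradient_nonzero[OF e]])
  qed
qed

lemma continuous_on_outward_normal:
  assumes "open \<Omega>" "smooth_boundary \<Omega>"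
  shows "continuous_on (frontier \<Omega>) (outward_normal \<Omega>)"
proof (subst continuous_on_eq_continuous_within, intro ballI)
  fix x assume x: "x \<in> frontier \<Omega>"
  then obtain r e \<gamma> where lg: "local_graph \<Omega> x r e \<gamma>"
    using assms(2) unfolding smooth_boundary_def by blast
  then have r: "0 < r" and e: "norm e = 1" and \<gamma>: "smooth_on UNIV \<gamma>"
    by (auto simp: local_graph_def)
  have "continuous_on (frontier \<Omega>) (\<lambda>y. sgn (graph_gradient e \<gamma> y))"
    unfolding sgn_div_norm
    by (intro continuous_intros continuous_on_graph_gradient \<gamma>) (simp add: graph_gradient_nonzero e)
  then have "continuous (at x within frontier \<Omega>) (\<lambda>y. sgn (graph_gradient e \<gamma> y))"
    using x by (simp add: continuous_on_eq_continuous_within)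
  then show "continuous (at x within frontier \<Omega>) (outward_normal \<Omega>)"
    by (rule continuous_transform_within[OF _ r x])
      (simp add: outward_normal_eq[OF assms(1) lg] dist_commute)
qed

lemma outward_normal_enters:
  assumes "open \<Omega>" "smooth_boundary \<Omega>" "x \<in> frontier \<Omega>"
  shows "\<forall>\<^sub>F t in at_left 0. x + t *\<^sub>R outward_normal \<Omega> x \<in> \<Omega>"
proof -
  obtain r e \<gamma> where lg: "local_graph \<Omega> x r e \<gamma>"
    using assms(2,3) unfolding smooth_boundary_def by blast
  then have r: "0 < r" and e: "norm e = 1" and \<gamma>: "smooth_on UNIV \<gamma>"
    by (auto simp: local_graph_def)
  let ?w = "graph_gradient e \<gamma> x"
  have "?w \<noteq> 0" by (rule graph_gradient_nonzero[OF e])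
  then have "- sgn ?w \<bullet> ?w < 0" by (simp add: sgn_div_norm inner_gt_zero_iff)
  from local_graph_enter[OF assms(1) lg assms(3) graph_fun_gderiv[OF \<gamma>] this]
  have "\<forall>\<^sub>F t in at_right 0. x + t *\<^sub>R (- outward_normal \<Omega> x) \<in> \<Omega>"
    using outward_normal_eq[OF assms(1) lg assms(3)] r by simp
  then have "eventually (\<lambda>t. x + t *\<^sub>R outward_normal \<Omega> x \<in> \<Omega>) (filtermap uminus (at_right 0))"
    unfolding eventually_filtermap by simp
  then show ?thesis
    using at_left_minus[of "0::real"] by simp
qed

section \<open>Normal derivatives\<close>

lemma normal_derivative_eqI:
  assumes "has_normal_derivative \<Omega> f x d"
  shows "normal_derivative \<Omega> f x = d"
proof -
  have "d' = d" if "has_normal_derivative \<Omega> f x d'" for d'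
    using that assms unfolding has_normal_derivative_def has_field_derivative_iff
    by (rule tendsto_unique[OF trivial_limit_at_left_real])
  with assms show ?thesis unfolding normal_derivative_def by blast
qed

text \<open>
  The normal line at small negative parameters lies inside the domain, so the difference quotients only
  see values of \<open>f\<close> on the closure.
\<close>

lemma has_normal_derivative_of_extension:
  assumes "open \<Omega>" "smooth_boundary \<Omega>" "x \<in> frontier \<Omega>"
    and "open U" "x \<in> U" "g differentiable (at x)" "\<And>y. y \<in> U \<inter> closure \<Omega> \<Longrightarrow> g y = f y"
  shows "has_normal_derivative \<Omega> f x (outward_normal \<Omega> x \<bullet> (\<chi> i. partial i g x))"
proof -
  let ?\<nu> = "outward_normal \<Omega> x"
  have "GDERIV g x :> (\<chi> i. partial i g x)"
    unfolding gderiv_def by (rule has_derivative_partials[OF assms(6)])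
  from has_field_derivative_at_within[OF gderiv_along_line[OF this, of ?\<nu>]]
  have "((\<lambda>t. (g (x + t *\<^sub>R ?\<nu>) - g (x + 0 *\<^sub>R ?\<nu>)) / (t - 0)) \<longlongrightarrow> ?\<nu> \<bullet> (\<chi> i. partial i g x)) (at_left 0)"
    unfolding has_field_derivative_iff .
  moreover have "\<forall>\<^sub>F t in at_left 0. (g (x + t *\<^sub>R ?\<nu>) - g (x + 0 *\<^sub>R ?\<nu>)) / (t - 0)
      = (f (x + t *\<^sub>R ?\<nu>) - f (x + 0 *\<^sub>R ?\<nu>)) / (t - 0)"
    using outward_normal_enters[OF assms(1-3)] eventually_line_in_open[OF assms(4,5), where v = ?\<nu> and S = "{..<0}"]
  proof eventually_elim
    case (elim t)
    then have "x + t *\<^sub>R ?\<nu> \<in> U \<inter> closure \<Omega>" using closure_subset by blast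
    moreover have "x \<in> U \<inter> closure \<Omega>" using assms(3,5) by (simp add: frontier_def)
    ultimately show ?case by (simp add: assms(7))
  qed
  ultimately show ?thesis
    unfolding has_normal_derivative_def has_field_derivative_iff by (rule Lim_transform_eventually)
qed

text \<open>
  As \<open>f\<close> vanishes at \<open>x\<close>, the difference quotient of the product is that of \<open>f\<close> times a value of
  \<open>\<phi>\<close>, and only the limit of the latter enters.
\<close>

lemma has_normal_derivative_mult_vanishing:
  assumes "has_normal_derivative \<Omega> f x d" "f x = 0" "isCont \<phi> x"
  shows "has_normal_derivative \<Omega> (\<lambda>y. f y * \<phi> y) x (d * \<phi> x)"
proof -
  let ?\<nu> = "outward_normal \<Omega> x"
  have "((\<lambda>t. x + t *\<^sub>R ?\<nu>) \<longlongrightarrow> x + 0 *\<^sub>R ?\<nu>) (at_left 0)" by (intro tendsto_intros)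
  then have "((\<lambda>t. \<phi> (x + t *\<^sub>R ?\<nu>)) \<longlongrightarrow> \<phi> x) (at_left 0)"
    using isCont_tendsto_compose[OF assms(3)] by simp
  from tendsto_mult[OF assms(1)[unfolded has_normal_derivative_def has_field_derivative_iff] this]
  show ?thesis
    unfolding has_normal_derivative_def has_field_derivative_iff by (simp add: assms(2) ac_simps)
qed

lemma normal_derivative_smooth:
  assumes "open \<Omega>" "smooth_boundary \<Omega>" "smooth_on (closure \<Omega>) f"
  shows "x \<in> frontier \<Omega> \<Longrightarrow> has_normal_derivative \<Omega> f x (normal_derivative \<Omega> f x)"
    and "continuous_on (frontier \<Omega>) (normal_derivative \<Omega> f)"
proof -
  have ext: "\<exists>U g. open U \<and> x \<in> U \<and> Ck_on 1 g U \<and> (\<forall>z\<in>U \<inter> closure \<Omega>. g z = f z)"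
    if "x \<in> frontier \<Omega>" for x
    using assms(3) that unfolding smooth_on_def frontier_def by blast
  have nd: "has_normal_derivative \<Omega> f y (outward_normal \<Omega> y \<bullet> (\<chi> i. partial i g y))"
    if "open U" "Ck_on 1 g U" "\<forall>z\<in>U \<inter> closure \<Omega>. g z = f z" "y \<in> frontier \<Omega>" "y \<in> U" for U g y
    using that by (intro has_normal_derivative_of_extension[OF assms(1,2) _ that(1)]) auto
  show "has_normal_derivative \<Omega> f x (normal_derivative \<Omega> f x)" if "x \<in> frontier \<Omega>" for x
    using ext[OF that] nd[OF _ _ _ that] normal_derivative_eqI by metis
  show "continuous_on (frontier \<Omega>) (normal_derivative \<Omega> f)"
  proof (subst continuous_on_eq_continuous_within, intro ballI)
    fix x assume x: "x \<in> frontier \<Omega>"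
    obtain U g where U: "open U" "x \<in> U" "Ck_on 1 g U" "\<forall>z\<in>U \<inter> closure \<Omega>. g z = f z"
      using ext[OF x] by blast
    let ?h = "\<lambda>y. outward_normal \<Omega> y \<bullet> (\<chi> i. partial i g y)"
    have "continuous_on U (\<lambda>y. \<chi> i. partial i g y)"
      using U(3) by (intro continuous_on_vec_lambda) simp
    then have "continuous_on (U \<inter> frontier \<Omega>) ?h"
      by (intro continuous_on_inner continuous_on_subset[OF continuous_on_outward_normal[OF assms(1,2)]])
        (auto intro: continuous_on_subset)
    moreover have "normal_derivative \<Omega> f y = ?h y" if "y \<in> U \<inter> frontier \<Omega>" for y
      using nd[OF U(1,3,4)] that by (intro normal_derivative_eqI) auto
    ultimately have "continuous_on (frontier \<Omega> \<inter> U) (normal_derivative \<Omega> f)"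
      by (subst continuous_on_cong[OF refl, of _ _ ?h]) (auto simp: Int_commute)
    then have "continuous (at x within frontier \<Omega> \<inter> U) (normal_derivative \<Omega> f)"
      using U(2) x by (simp add: continuous_on_eq_continuous_within)
    then show "continuous (at x within frontier \<Omega>) (normal_derivative \<Omega> f)"
      using at_within_nhd[OF U(2,1), of "frontier \<Omega> \<inter> U" "frontier \<Omega>"]
      by (simp add: continuous_within Int_assoc)
  qed
qed

section \<open>Existence of the damped function\<close>

context shrinking_ball_covers
begin

text \<open>
  The left-hand side is also the integrand \<open>\<zeta> |D\<^sup>2u| / u\<close> of the weighted condition, because
  \<open>\<zeta> / u\<close> is the height.
\<close>

lemma damped_hessian_bound:
  assumes "open \<Omega>" "\<Omega> \<inter> K = {}" "x \<in> \<Omega>" "Ck_on 2 \<zeta> \<Omega>"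
    and "0 \<le> \<zeta> x" "\<And>y. y \<in> K \<Longrightarrow> \<zeta> x \<le> L * dist y x" "0 \<le> L" "0 \<le> M"
    and "\<And>i. \<bar>partial i \<zeta> x\<bar> \<le> M" "\<And>i j. \<bar>partial i (partial j \<zeta>) x\<bar> \<le> M"
  shows "height x * norm (hessian (\<lambda>z. \<zeta> z * damping z) x)
    \<le> (real CARD('n))\<^sup>2 * (M + (40 * M + 3600 * L) * majorant x)"
proof -
  have "x \<notin> K" using assms(2,3) by blast
  then obtain V and I :: "(nat \<times> (real^'n) \<times> real) set" where V:
    "open V" "x \<in> V" "V \<inter> K = {}" "finite I"
    "\<And>i. i \<in> I \<Longrightarrow> fst (snd i) \<in> K \<and> 0 < snd (snd i)"
    "\<And>z. z \<in> V \<Longrightarrow> height z = 1 + (\<Sum>i\<in>I. bump (fst (snd i)) (snd (snd i)) z)"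
    "\<And>z. z \<in> V \<Longrightarrow> majorant z
        = (\<Sum>i\<in>I. 1 / snd (snd i) * indicator (ball (fst (snd i)) (2 * snd (snd i))) z)"
    by (rule height_local) blast
  let ?u = "\<lambda>z. \<zeta> z * damping z"
  let ?B = "M + (40 * M + 3600 * L) * majorant x"
  have U: "open (V \<inter> \<Omega>)" "x \<in> V \<inter> \<Omega>" using V(1,2) assms(1,3) by auto
  have entry: "height x * \<bar>partial i (partial j ?u) x\<bar> \<le> ?B" for i j
  proof -
    let ?h = "\<lambda>z. 1 + (\<Sum>i\<in>I. bump (fst (snd i)) (snd (snd i)) z)"
    have "partial i (partial j ?u) x = partial i (partial j (\<lambda>z. \<zeta> z * inverse (?h z))) x"
      by (rule second_partial_cong[OF U]) (use V(3,6) in \<open>auto simp: damping_def\<close>)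
    moreover have "?h x * \<bar>partial i (partial j (\<lambda>z. \<zeta> z * inverse (?h z))) x\<bar>
        \<le> M + (40 * M + 3600 * L) *
          (\<Sum>i\<in>I. 1 / snd (snd i) * indicator (ball (fst (snd i)) (2 * snd (snd i))) x)"
      by (rule damped_hessian_entry_bound[OF V(4) _ U Ck_on_subset[OF assms(4)] assms(5) _ assms(7-10)])
        (use V(5) assms(6) in auto)
    ultimately show ?thesis using V(6,7)[OF V(2)] by simp
  qed
  have "height x * norm (hessian ?u x)
      \<le> height x * (\<Sum>i\<in>UNIV. \<Sum>j\<in>UNIV. \<bar>hessian ?u x $ i $ j\<bar>)"
    using height_ge_1[OF \<open>x \<notin> K\<close>] by (intro mult_left_mono norm_matrix_le) auto
  also have "\<dots> = (\<Sum>i\<in>UNIV. \<Sum>j\<in>UNIV. height x * \<bar>partial i (partial j ?u) x\<bar>)"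
    by (simp add: sum_distrib_left hessian_def)
  also have "\<dots> \<le> (\<Sum>i\<in>(UNIV :: 'n set). \<Sum>j\<in>(UNIV :: 'n set). ?B)"
    by (intro sum_mono entry)
  also have "\<dots> = (real CARD('n))\<^sup>2 * ?B" by (simp add: power2_eq_square)
  finally show ?thesis .
qed

end

lemma laplacian_eq_trace: "laplacian f x = (\<Sum>i\<in>UNIV. hessian f x $ i $ i)"
  by (simp add: laplacian_def hessian_def)

lemma bounded_linear_trace: "bounded_linear (\<lambda>A :: real^'n::finite^'n. \<Sum>i\<in>UNIV. A $ i $ i)"
  by (intro bounded_linear_sum bounded_linear_compose[OF bounded_linear_vec_nth bounded_linear_vec_nth])

theorem proposition7p1:
  fixes \<Omega> K :: "(real^'n::finite) set" and \<zeta> :: "real^'n \<Rightarrow> real"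
  assumes "open \<Omega>" and "bounded \<Omega>" and "connected \<Omega>" and "smooth_boundary \<Omega>"
    and "\<zeta> \<in> C0_infty_closure \<Omega>" and "\<forall>x\<in>\<Omega>. \<zeta> x > 0"
    and "compact K" and "K \<subseteq> frontier \<Omega>" and "hausdorff_measure (CARD('n) - 1) K = 0"
  shows "\<exists>u :: real^'n \<Rightarrow> real.
      smooth_on (closure \<Omega> - K) u \<and> u \<in> C0_closure \<Omega> \<and>
      (\<forall>x\<in>\<Omega>. 0 < u x \<and> u x \<le> \<zeta> x) \<and>
      integrable (lebesgue_on \<Omega>) (hessian u) \<and>
      integrable (weighted_lebesgue_on \<Omega> \<zeta>) (\<lambda>x. hessian u x /\<^sub>R u x) \<and>
      (\<forall>x\<in>frontier \<Omega>. \<exists>d. has_normal_derivative \<Omega> u x d) \<and>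
      continuous_on (frontier \<Omega>) (normal_derivative \<Omega> u) \<and>
      (\<forall>x\<in>frontier \<Omega>. normal_derivative \<Omega> u x = 0 \<longleftrightarrow>
          x \<in> K \<or> normal_derivative \<Omega> \<zeta> x = 0) \<and>
      (let V = (\<lambda>x. laplacian u x / u x) in
         integrable (weighted_lebesgue_on \<Omega> \<zeta>) V \<and>
         integrable (lebesgue_on \<Omega>) (\<lambda>x. V x * u x) \<and>
         (\<forall>x\<in>\<Omega>. - laplacian u x + V x * u x = 0))"
proof -
  have \<zeta>: "smooth_on (closure \<Omega>) \<zeta>" "\<And>x. x \<in> frontier \<Omega> \<Longrightarrow> \<zeta> x = 0"
    using assms(5) by (auto simp: C0_infty_closure_def)
  have pos: "0 < \<zeta> x" if "x \<in> \<Omega>" for x using assms(6) that by blast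
  obtain F where "shrinking_ball_covers K F"
    using shrinking_ball_covers_exist[OF assms(7,9)] .
  then interpret shrinking_ball_covers K F .
  have disj: "\<Omega> \<inter> K = {}"
    using assms(1,8) by (auto simp: frontier_def interior_open)
  define u where "u = (\<lambda>x. \<zeta> x * damping x)"
  have u_pos: "0 < u x" and u_le: "u x \<le> \<zeta> x" and u_height: "\<zeta> x = height x * u x" if "x \<in> \<Omega>" for x
  proof -
    have "x \<notin> K" using disj that by blast
    then show "0 < u x" "\<zeta> x = height x * u x"
      using pos[OF that] damping_pos[of x] height_ge_1[of x] by (auto simp: u_def damping_def)
    show "u x \<le> \<zeta> x"
      using pos[OF that] damping_le_1[of x] by (simp add: u_def)
  qed

  have smooth: "smooth_on (closure \<Omega> - K) u"
    unfolding smooth_on_def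
  proof
    fix x assume x: "x \<in> closure \<Omega> - K"
    then obtain U g where U: "open U" "x \<in> U" "\<forall>k. Ck_on k g U" "\<forall>y\<in>U \<inter> closure \<Omega>. g y = \<zeta> y"
      using \<zeta>(1) unfolding smooth_on_def by blast
    have o: "open (U \<inter> - K)" using U(1) open_minus_K by (rule open_Int)
    have "Ck_on k (\<lambda>z. g z * damping z) (U \<inter> - K)" for k
      using U(3) Ck_on_damping by (intro Ck_on_mult o) (auto intro: Ck_on_subset)
    with o U x show "\<exists>U g. open U \<and> x \<in> U \<and> (\<forall>k. Ck_on k g U) \<and> (\<forall>y\<in>U \<inter> (closure \<Omega> - K). g y = u y)"
      by (intro exI[of _ "U \<inter> - K"] exI[of _ "\<lambda>z. g z * damping z"]) (auto simp: u_def)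
  qed

  have cont_damping: "continuous_on S damping" for S
    by (intro continuous_at_imp_continuous_on ballI isCont_damping)
  have C0: "u \<in> C0_closure \<Omega>"
    using \<zeta>(2) smooth_on_imp_continuous_on[OF \<zeta>(1)] cont_damping
    by (auto simp: C0_closure_def u_def intro!: continuous_on_mult)

  have Ck_\<zeta>: "Ck_on k \<zeta> \<Omega>" for k
    using smooth_on_open_imp_Ck_on[OF assms(1) smooth_on_subset[OF \<zeta>(1) closure_subset]] .
  have Ck_u: "Ck_on k u \<Omega>" for k
    unfolding u_def using disj
    by (intro Ck_on_mult assms(1) Ck_\<zeta> Ck_on_subset[OF Ck_on_damping]) auto

  obtain M where M: "0 \<le> M" "\<And>x i. x \<in> \<Omega> \<Longrightarrow> \<bar>partial i \<zeta> x\<bar> \<le> M"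
      "\<And>x i j. x \<in> \<Omega> \<Longrightarrow> \<bar>partial i (partial j \<zeta>) x\<bar> \<le> M"
    using smooth_on_closure_bounded_derivatives[OF assms(1,2) \<zeta>(1)] by blast
  define L where "L = real CARD('n) * M"
  have L: "0 \<le> L" using M(1) by (simp add: L_def)
  have dist: "\<zeta> x \<le> L * dist y x" if "x \<in> \<Omega>" "y \<in> K" for x y
  proof -
    have "\<zeta> differentiable (at z)" if "z \<in> \<Omega>" for z using Ck_\<zeta>[of 1] that by simp
    then have "\<bar>\<zeta> x\<bar> \<le> L * dist y x"
      unfolding L_def using that assms(8)
      by (intro boundary_distance_bound[OF assms(1) smooth_on_imp_continuous_on[OF \<zeta>(1)] \<zeta>(2)] M(2)) auto
    then show ?thesis by simp
  qed
  define B where "B x = (real CARD('n))\<^sup>2 * (M + (40 * M + 3600 * L) * majorant x)" for x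
  have bound: "height x * norm (hessian u x) \<le> B x" if "x \<in> \<Omega>" for x
    unfolding B_def u_def
    using pos[OF that] dist[OF that] M that L
    by (intro damped_hessian_bound[OF assms(1) disj that Ck_\<zeta>]) auto
  have h1: "1 \<le> height x" if "x \<in> \<Omega>" for x using height_ge_1 disj that by blast

  have \<Omega>_sets: "\<Omega> \<in> sets lebesgue" using assms(1) by simp
  interpret finite_measure "lebesgue_on \<Omega>"
    using lmeasurable_open[OF assms(2,1)] by (rule finite_measure_lebesgue_on)
  have int_B: "integrable (lebesgue_on \<Omega>) B"
    unfolding B_def[abs_def]
    by (intro integrable_mult_right Bochner_Integration.integrable_add integrable_const
        integrable_majorant \<Omega>_sets disj)
  have cont_H: "continuous_on \<Omega> (hessian u)" by (rule continuous_on_hessian[OF assms(1) Ck_u])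
  have cont_u: "continuous_on \<Omega> u" using Ck_u[of 0] by simp
  have cont_\<zeta>: "continuous_on \<Omega> \<zeta>" using Ck_\<zeta>[of 0] by simp
  have cont_Hu: "continuous_on \<Omega> (\<lambda>x. hessian u x /\<^sub>R u x)"
    using u_pos by (intro continuous_intros cont_H cont_u) force
  have meas: "f \<in> borel_measurable (lebesgue_on \<Omega>)" if "continuous_on \<Omega> f"
    for f :: "real^'n \<Rightarrow> 'b::{second_countable_topology,t2_space}"
    by (rule continuous_imp_measurable_on_sets_lebesgue[OF that \<Omega>_sets])
  \<comment> \<open>the height is at least \<open>1\<close>, so the bound for the weighted integrand covers the plain Hessian\<close>
  have int_H: "integrable (lebesgue_on \<Omega>) (hessian u)"
  proof (rule Bochner_Integration.integrable_bound[OF int_B meas[OF cont_H]], rule AE_I2)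
    fix x assume "x \<in> space (lebesgue_on \<Omega>)"
    then have x: "x \<in> \<Omega>" by simp
    have "1 * norm (hessian u x) \<le> height x * norm (hessian u x)"
      using h1[OF x] by (intro mult_right_mono) auto
    with bound[OF x] show "norm (hessian u x) \<le> norm (B x)" by simp
  qed
  \<comment> \<open>the weight \<open>\<zeta>\<close> divided by \<open>u\<close> is the height, so the bound applies to the integrand as it stands\<close>
  have int_Hu: "integrable (weighted_lebesgue_on \<Omega> \<zeta>) (\<lambda>x. hessian u x /\<^sub>R u x)"
    unfolding weighted_lebesgue_on_def
  proof (subst integrable_density)
    show "AE x in lebesgue_on \<Omega>. 0 \<le> \<zeta> x"
      by (rule AE_I2) (use pos in \<open>auto intro: less_imp_le\<close>)
    show "integrable (lebesgue_on \<Omega>) (\<lambda>x. \<zeta> x *\<^sub>R (hessian u x /\<^sub>R u x))"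
    proof (rule Bochner_Integration.integrable_bound[OF int_B], rule meas)
      show "continuous_on \<Omega> (\<lambda>x. \<zeta> x *\<^sub>R (hessian u x /\<^sub>R u x))"
        by (intro continuous_on_scaleR cont_\<zeta> cont_Hu)
      show "AE x in lebesgue_on \<Omega>. norm (\<zeta> x *\<^sub>R (hessian u x /\<^sub>R u x)) \<le> norm (B x)"
      proof (rule AE_I2)
        fix x assume "x \<in> space (lebesgue_on \<Omega>)"
        then have x: "x \<in> \<Omega>" by simp
        have eq: "\<zeta> x *\<^sub>R (hessian u x /\<^sub>R u x) = height x *\<^sub>R hessian u x"
          unfolding u_height[OF x] using u_pos[OF x] by simp
        show "norm (\<zeta> x *\<^sub>R (hessian u x /\<^sub>R u x)) \<le> norm (B x)"
          unfolding eq using bound[OF x] h1[OF x] by simp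
      qed
    qed
  qed (intro meas cont_\<zeta> cont_Hu)+

  have nd: "has_normal_derivative \<Omega> u x (normal_derivative \<Omega> \<zeta> x * damping x)" if "x \<in> frontier \<Omega>" for x
    unfolding u_def
    by (rule has_normal_derivative_mult_vanishing[OF normal_derivative_smooth(1)[OF assms(1,4) \<zeta>(1) that]
          \<zeta>(2)[OF that] isCont_damping])
  note nd_eq = normal_derivative_eqI[OF nd]
  have "continuous_on (frontier \<Omega>) (\<lambda>x. normal_derivative \<Omega> \<zeta> x * damping x)"
    by (intro continuous_on_mult normal_derivative_smooth(2)[OF assms(1,4) \<zeta>(1)] cont_damping)
  moreover have "continuous_on (frontier \<Omega>) (normal_derivative \<Omega> u)
      \<longleftrightarrow> continuous_on (frontier \<Omega>) (\<lambda>x. normal_derivative \<Omega> \<zeta> x * damping x)"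
    by (rule continuous_on_cong[OF refl]) (rule nd_eq)
  ultimately have cont_nd: "continuous_on (frontier \<Omega>) (normal_derivative \<Omega> u)" by blast
  have nd_iff: "normal_derivative \<Omega> u x = 0 \<longleftrightarrow> x \<in> K \<or> normal_derivative \<Omega> \<zeta> x = 0"
    if "x \<in> frontier \<Omega>" for x
  proof -
    have "damping x = 0 \<longleftrightarrow> x \<in> K" using damping_pos[of x] by (cases "x \<in> K") (simp_all add: damping_def)
    then show ?thesis unfolding nd_eq[OF that] mult_eq_0_iff by blast
  qed

  let ?V = "\<lambda>x. laplacian u x / u x"
  have "?V = (\<lambda>x. \<Sum>i\<in>UNIV. (hessian u x /\<^sub>R u x) $ i $ i)"
    by (simp add: laplacian_eq_trace divide_inverse mult.commute[of _ "inverse (u _)"] sum_distrib_left)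
  then have int_V: "integrable (weighted_lebesgue_on \<Omega> \<zeta>) ?V"
    using integrable_bounded_linear[OF bounded_linear_trace int_Hu] by simp
  have Vu: "?V x * u x = laplacian u x" if "x \<in> \<Omega>" for x using u_pos[OF that] by simp
  have "integrable (lebesgue_on \<Omega>) (laplacian u)"
    using integrable_bounded_linear[OF bounded_linear_trace int_H]
    by (simp add: laplacian_eq_trace[abs_def])
  then have int_Vu: "integrable (lebesgue_on \<Omega>) (\<lambda>x. ?V x * u x)"
    by (rule Bochner_Integration.integrable_cong[OF refl Vu, THEN iffD2, rotated]) simp

  have nd_ex: "\<exists>d. has_normal_derivative \<Omega> u x d" if "x \<in> frontier \<Omega>" for x
    using nd[OF that] by (rule exI)
  have schroedinger: "- laplacian u x + ?V x * u x = 0" if "x \<in> \<Omega>" for x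
    unfolding Vu[OF that] by simp
  show ?thesis
    unfolding Let_def
    by (intro exI[of _ u] conjI ballI schroedinger smooth C0 u_pos u_le int_H int_Hu nd_ex cont_nd nd_iff
        int_V int_Vu)
qed

end
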